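(* Let $f\in\mathcal{C}^2(\mathbb{R}^2)$ be supported in $\mathbb{B}^\circ$, let $(m,n)\in\mathbb{Z}\times\mathbb{N}$ and $\phi\in[0,2\pi)$. Let $R_\phi f(r,\theta):=f(r,\theta+\phi)$ (in polar coordinates). Then $$\left|C_{m,n}^{K}(R_\phi f)-e^{\mathrm{i}m\phi}C_{m,n}^{K}(f)\right|=\mathcal{O}(1/K)\qquad\text{for } K\ge K_{m,n},$$ that is, there is a constant $A>0$ such that the left-hand side is at most $A/K$ for every $K\in\mathbb{N}$ with $K\ge K_{m,n}$.
   Context: $\mathbb{N}=\{1,2,\dots\}$. $\mathbb{B}^\circ$ is the open unit disk of $\mathbb{R}^2$; $\mathrm{supp}(f)=\{\mathbf{x}: f(\mathbf{x})\neq 0\}$ and $f$ is supported in $X$ if $\mathrm{supp}(f)\subseteq X$. $\mathcal{C}^q(\mathbb{R}^2)$ is the set of functions $\mathbb{R}^2\to\mathbb{C}$ all of whose partial derivatives of order $\le q$ exist and are continuous. Bessel notation: $J_m$ is the Bessel function of the first kind of order $m\in\mathbb{Z}$, $0<z_{m,1}<z_{m,2}<\cdots$ are its positive zeros, and $K_{m,n}:=\lceil z_{m,n}/\pi\rceil$. Finite Fourier transform: for $L\in\mathbb{N}$, $\mathbf{k}\in\mathbb{Z}^2$, $\widehat f(\mathbf{k};L)=\delta^2\sum_{i=1}^L\sum_{j=1}^L f(x_i,x_j)e^{-\pi\mathrm{i}(k_1x_i+k_2x_j)}$ with $\delta=2/L$, $x_i=-1+(i-1)\delta$ (here $f(x_i,x_j)$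 is in Cartesian coordinates). Coefficients: for $\mathbf{k}=(k_1,k_2)\in\mathbb{Z}^2$, $\mathbf{c}(\mathbf{k};m,n)=\varepsilon_m\sqrt{\pi}(-1)^n\mathrm{i}^m z_{m,n}\frac{J_m(\pi\|\mathbf{k}\|_2)e^{-\mathrm{i}m\Phi(\mathbf{k})}}{2(\pi^2\|\mathbf{k}\|_2^2-z_{m,n}^2)}$, where $\varepsilon_m=1$ if $m\ge0$, $\varepsilon_m=(-1)^m$ if $m<0$, and $\Phi(\mathbf{k})=\mathrm{atan2}(k_2,k_1)$ is the polar angle of $\mathbf{k}$ (with value $0$ at $\mathbf{k}=0$). If $\pi\|\mathbf{k}\|_2=z_{m,n}$, the quotient $J_m(\pi\|\mathbf{k}\|_2)/(\pi^2\|\mathbf{k}\|_2^2-z_{m,n}^2)$ is understood as its limiting value $J_m'(z_{m,n})/(2z_{m,n})$. Finite Fourier-Bessel transform of order $K\in\mathbb{N}$: $C_{m,n}^K(f)=\sum_{\mathbf{k}\in\mathbb{Z}^2,\ \|\mathbf{k}\|_\infty\le K}\mathbf{c}(\mathbf{k};m,n)\,\widehat f(\mathbf{k};2K+1)$. *)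

theory Defs
  imports "HOL-Analysis.Analysis"
begin

text \<open>
  Points of the Euclidean plane are elements of \<^typ>\<open>real \<times> real\<close>; its \<^const>\<open>norm\<close> is the
  Euclidean one, so the open unit disk is \<^term>\<open>ball (0 :: real \<times> real) 1\<close>.
\<close>

fun Cq :: "nat \<Rightarrow> (real \<times> real \<Rightarrow> complex) \<Rightarrow> bool" where
  "Cq 0 f \<longleftrightarrow> continuous_on UNIV f"
| "Cq (Suc q) f \<longleftrightarrow> continuous_on UNIV f \<and>
     (\<forall>x y. (\<lambda>t. f (t, y)) differentiable (at x) \<and> (\<lambda>t. f (x, t)) differentiable (at y)) \<and>
     Cq q (\<lambda>(x, y). vector_derivative (\<lambda>t. f (t, y)) (at x)) \<and>
     Cq q (\<lambda>(x, y). vector_derivative (\<lambda>t. f (x, t)) (at y))"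

definition polar :: "real \<Rightarrow> real \<Rightarrow> real \<times> real" where
  "polar r \<theta> = (r * cos \<theta>, r * sin \<theta>)"

text \<open>\<^const>\<open>Arg\<close> takes values in \<open>(-\<pi>, \<pi>]\<close> and is \<open>0\<close> at the origin, so this is \<open>atan2 y x\<close>.\<close>

definition polar_angle :: "real \<times> real \<Rightarrow> real" where
  "polar_angle p = Arg (Complex (fst p) (snd p))"

definition rotate_fun :: "real \<Rightarrow> (real \<times> real \<Rightarrow> complex) \<Rightarrow> real \<times> real \<Rightarrow> complex" where
  "rotate_fun \<phi> f p = f (polar (norm p) (polar_angle p + \<phi>))"

text \<open>
  For negative \<open>m\<close> the terms with \<open>m + k < 0\<close> vanish because \<^const>\<open>rGamma\<close> is zero at the
  non-positive integers; in particular nothing singular happens at \<open>x = 0\<close>.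
\<close>

definition bessel_J :: "int \<Rightarrow> real \<Rightarrow> real" where
  "bessel_J m x = (\<Sum>k. (-1) ^ k / fact k * rGamma (of_int m + of_nat k + 1)
                        * (x / 2) powi (m + 2 * int k))"

text \<open>
  The \<open>n\<close>-th positive zero, counted from \<open>n = 1\<close>. For \<open>n \<ge> 1\<close> the cardinality condition
  includes finiteness of the set, as infinite sets have cardinality \<open>0\<close>.
\<close>

definition bessel_zero :: "int \<Rightarrow> nat \<Rightarrow> real" where
  "bessel_zero m n = (THE z. 0 < z \<and> bessel_J m z = 0 \<and>
                             card {x. 0 < x \<and> x \<le> z \<and> bessel_J m x = 0} = n)"

definition bessel_K :: "int \<Rightarrow> nat \<Rightarrow> int" where
  "bessel_K m n = \<lceil>bessel_zero m n / pi\<rceil>"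

definition grid :: "nat \<Rightarrow> nat \<Rightarrow> real" where
  "grid L i = -1 + (real i - 1) * (2 / real L)"

definition finite_fourier :: "(real \<times> real \<Rightarrow> complex) \<Rightarrow> nat \<Rightarrow> int \<times> int \<Rightarrow> complex" where
  "finite_fourier f L k = of_real ((2 / real L)\<^sup>2) *
     (\<Sum>i=1..L. \<Sum>j=1..L. f (grid L i, grid L j) *
        exp (- of_real pi * \<i> * of_real (of_int (fst k) * grid L i + of_int (snd k) * grid L j)))"

definition real_pair :: "int \<times> int \<Rightarrow> real \<times> real" where
  "real_pair k = (of_int (fst k), of_int (snd k))"

definition bessel_quotient :: "int \<Rightarrow> nat \<Rightarrow> real \<Rightarrow> real" where
  "bessel_quotient m n \<rho> =
     (let z = bessel_zero m n in
      if \<rho> = z then deriv (bessel_J m) z / (2 * z) else bessel_J m \<rho> / (\<rho>\<^sup>2 - z\<^sup>2))"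

definition epsilon_sign :: "int \<Rightarrow> complex" where
  "epsilon_sign m = (if m \<ge> 0 then 1 else (-1) powi m)"

definition coeff_c :: "int \<times> int \<Rightarrow> int \<Rightarrow> nat \<Rightarrow> complex" where
  "coeff_c k m n = epsilon_sign m * of_real (sqrt pi) * (-1) ^ n * \<i> powi m
     * of_real (bessel_zero m n)
     * (of_real (bessel_quotient m n (pi * norm (real_pair k)))
        * exp (- \<i> * of_int m * of_real (polar_angle (real_pair k))) / 2)"

definition fourier_bessel :: "nat \<Rightarrow> int \<Rightarrow> nat \<Rightarrow> (real \<times> real \<Rightarrow> complex) \<Rightarrow> complex" where
  "fourier_bessel K m n f =
     (\<Sum>k | max \<bar>fst k\<bar> \<bar>snd k\<bar> \<le> int K. coeff_c k m n * finite_fourier f (2 * K + 1) k)"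

end

theory Submission
  imports Defs "HOL-Complex_Analysis.Conformal_Mappings"
begin

text \<open>
  Let \<open>W\<close> be the function \<open>J\<^sub>m(z r) e\<^sup>-\<^sup>i\<^sup>m\<^sup>\<theta>\<close> on the unit disk, extended by \<open>0\<close>, where \<open>z\<close> is the zero
  \<open>z\<^sub>m\<^sub>,\<^sub>n\<close>. Because \<open>J\<^sub>m(z) = 0\<close>, Lommel's integral shows that \<open>\<^bold>c(k; m, n)\<close> is a constant
  multiple of the Fourier coefficient \<open>\<integral> W e\<^sup>i\<^sup>\<pi>\<^sup>k\<^sup>x\<close>. Hence \<open>C\<^sup>K(f)\<close> is, up to this constant, the integral of \<open>W\<close>
  against the trigonometric polynomial of degree \<open>K\<close> interpolating \<open>f\<close> on the grid of \<open>(2K+1)\<^sup>2\<close> points.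
  Interpolation reproduces trigonometric polynomials and is bounded from the supremum norm on the
  grid to \<open>L\<^sup>2\<close>, so a Jackson approximation of the Lipschitz function \<open>f\<close> gives
  \<open>C\<^sup>K(f) = \<kappa> \<integral> W f + O(1/K)\<close>. The limit functional is exactly equivariant under rotations.
\<close>

section \<open>Rotations and radial integration in the plane\<close>

text \<open>For a fixed \<open>K\<close> neither the grid nor the square box of frequencies is
  invariant under rotations, so the two transforms admit no direct comparison. Each is compared with
  the limit functional, where invariance of Lebesgue measure gives the factor e^(i m \<phi>)
  exactly. Interpolation is measured in L^2 because its norm with respect to the supremum grows like
  a power of log K, whereas Parseval on the square gives an L^2 bound free of K. This is enough,
  since W is bounded and lives on a bounded set. The Jackson operator is itself discrete: it
  averages the values of f on the same grid, so the moments of its kernel are finite sums that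
  orthogonality evaluates. It needs f to be Lipschitz as a function of period 2 in each variable,
  and here the support condition enters: f vanishes on the boundary of [-1,1]^2. So does the rotated
  function, whose support stays in the disk.\<close>

lemma distr_lborel_shear_fst:
  "distr lborel borel (\<lambda>p::real \<times> real. (fst p + a * snd p, snd p)) = lborel"
proof (rule measure_eqI)
  fix A :: "(real \<times> real) set"
  assume "A \<in> sets (distr lborel borel (\<lambda>p::real \<times> real. (fst p + a * snd p, snd p)))"
  then have A[measurable]: "A \<in> sets borel" by simp
  \<comment> \<open>For fixed \<open>y\<close> the shear translates \<open>x\<close> by the constant
    \<open>a * y\<close>, so Tonelli reduces the claim to translation invariance on the
    line.\<close>
  have trans: "(\<integral>\<^sup>+x. indicator A (x + c, y) \<partial>lborel) = (\<integral>\<^sup>+x. indicator A (x, y) \<partial>lborel)" for c y :: real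
  proof -
    have "(\<integral>\<^sup>+x. indicator A (x, y) \<partial>distr lborel borel ((+) c)) = (\<integral>\<^sup>+x. indicator A (c + x, y) \<partial>lborel)"
      by (rule nn_integral_distr) auto
    then show ?thesis by (simp add: lborel_distr_plus add.commute)
  qed
  have [measurable]: "(\<lambda>p::real \<times> real. (fst p + a * snd p, snd p)) \<in> borel \<rightarrow>\<^sub>M borel"
    by (intro borel_measurable_continuous_onI continuous_intros)
  have "emeasure (distr lborel borel (\<lambda>p::real \<times> real. (fst p + a * snd p, snd p))) A
      = (\<integral>\<^sup>+p. indicator A p \<partial>distr lborel borel (\<lambda>p::real \<times> real. (fst p + a * snd p, snd p)))"
    by simp
  also have "\<dots> = (\<integral>\<^sup>+p. indicator A (fst p + a * snd p, snd p) \<partial>lborel)"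
    by (subst nn_integral_distr) auto
  also have "\<dots> = (\<integral>\<^sup>+p. indicator A (fst p + a * snd p, snd p) \<partial>(lborel \<Otimes>\<^sub>M lborel))"
    by (simp add: lborel_prod)
  also have "\<dots> = (\<integral>\<^sup>+y. \<integral>\<^sup>+x. indicator A (x + a * y, y) \<partial>lborel \<partial>lborel)"
    by (subst lborel_pair.nn_integral_snd[symmetric]) (auto simp: lborel_prod)
  also have "\<dots> = (\<integral>\<^sup>+y. \<integral>\<^sup>+x. indicator A (x, y) \<partial>lborel \<partial>lborel)"
    by (simp add: trans)
  also have "\<dots> = (\<integral>\<^sup>+p. indicator A p \<partial>(lborel \<Otimes>\<^sub>M lborel))"
    by (subst lborel_pair.nn_integral_snd) (auto simp: lborel_prod)
  also have "\<dots> = emeasure lborel A" by (simp add: lborel_prod)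
  finally show "emeasure (distr lborel borel (\<lambda>p::real \<times> real. (fst p + a * snd p, snd p))) A = emeasure lborel A" .
qed auto

lemma distr_lborel_swap: "distr lborel borel prod.swap = (lborel :: (real \<times> real) measure)"
proof -
  have "(\<lambda>(x, y). (y, x)) = (prod.swap :: real \<times> real \<Rightarrow> _)" by auto
  moreover have "distr (lborel \<Otimes>\<^sub>M lborel) (lborel \<Otimes>\<^sub>M lborel) (\<lambda>(x, y). (y, x))
      = (lborel \<Otimes>\<^sub>M lborel :: (real \<times> real) measure)"
    using lborel_pair.distr_pair_swap[symmetric] .
  ultimately have "distr lborel lborel prod.swap = (lborel :: (real \<times> real) measure)"
    by (simp add: lborel_prod)
  then show ?thesis by (simp cong: distr_cong)
qed

lemma distr_distr_distr:
  assumes "f \<in> M \<rightarrow>\<^sub>M N" "g \<in> N \<rightarrow>\<^sub>M K" "h \<in> K \<rightarrow>\<^sub>M L"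
  shows "distr (distr (distr M N f) K g) L h = distr M L (\<lambda>x. h (g (f x)))"
proof -
  have "distr (distr (distr M N f) K g) L h = distr M L (h \<circ> (g \<circ> f))"
    using assms by (simp add: distr_distr)
  then show ?thesis by (simp add: comp_def)
qed

lemma distr_lborel_shear_snd:
  "distr lborel borel (\<lambda>p::real \<times> real. (fst p, snd p + a * fst p)) = lborel"
proof -
  have m1: "(prod.swap :: real \<times> real \<Rightarrow> _) \<in> borel \<rightarrow>\<^sub>M borel"
    unfolding prod.swap_def by (intro borel_measurable_continuous_onI continuous_intros)
  have m2: "(\<lambda>p::real \<times> real. (fst p + a * snd p, snd p)) \<in> borel \<rightarrow>\<^sub>M borel"
    by (intro borel_measurable_continuous_onI continuous_intros)
  have "lborel = distr (distr (distr lborel borel prod.swap) borel (\<lambda>p::real \<times> real. (fst p + a * snd p, snd p))) borel prod.swap"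
    by (simp add: distr_lborel_swap distr_lborel_shear_fst)
  also have "\<dots> = distr lborel borel (\<lambda>p::real \<times> real. (fst p, snd p + a * fst p))"
    by (subst distr_distr_distr) (use m1 m2 in \<open>auto simp: prod.swap_def\<close>)
  finally show ?thesis by simp
qed

definition rotation :: "real \<Rightarrow> real \<times> real \<Rightarrow> real \<times> real" where
  "rotation t p = (fst p * cos t - snd p * sin t, fst p * sin t + snd p * cos t)"

lemma borel_measurable_rotation [measurable]: "rotation t \<in> borel \<rightarrow>\<^sub>M borel"
  unfolding rotation_def by (intro borel_measurable_continuous_onI continuous_intros)

lemma rotation_add: "rotation s (rotation t p) = rotation (s + t) p"
  by (simp add: rotation_def cos_add sin_add algebra_simps)

lemma norm_rotation [simp]: "norm (rotation t p) = norm p"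
proof -
  have "(x * cos t - y * sin t)\<^sup>2 + (x * sin t + y * cos t)\<^sup>2 = (x\<^sup>2 + y\<^sup>2) * ((sin t)\<^sup>2 + (cos t)\<^sup>2)" for x y
    by algebra
  then show ?thesis
    by (simp add: rotation_def norm_prod_def)
qed

text \<open>A rotation is a product of three shears, unless it is the half turn.\<close>

lemma distr_lborel_rotation: "distr lborel borel (rotation t) = lborel"
proof -
  have main: "distr lborel borel (rotation t) = lborel" if c: "cos (t / 2) \<noteq> 0" for t
  proof -
    \<comment> \<open>The product of the shears with parameters a, sin t, a has both diagonal
      entries equal to 1 + a sin t; equating them to cos t leads to this a.\<close>
    define a where "a = - tan (t / 2)"
    have *: "sin t = 2 * sin (t/2) * cos (t/2)" "cos t = 1 - 2 * (sin (t/2))\<^sup>2"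
      using sin_double[of "t/2"] cos_double_sin[of "t/2"] by simp_all
    have m1: "(\<lambda>p::real \<times> real. (fst p + a * snd p, snd p)) \<in> borel \<rightarrow>\<^sub>M borel"
      and m2: "(\<lambda>p::real \<times> real. (fst p, snd p + sin t * fst p)) \<in> borel \<rightarrow>\<^sub>M borel"
      by (intro borel_measurable_continuous_onI continuous_intros)+
    have as: "a * sin t = cos t - 1"
      using c by (simp add: a_def * tan_def power2_eq_square)
    have aa: "2 * a + a * (a * sin t) = - sin t"
    proof -
      have "2 * a + a * (a * sin t) = 2 * a * (cos (t/2))\<^sup>2"
        unfolding as *(2) by (simp add: cos_squared_eq algebra_simps)
      also have "\<dots> = - sin t" using c by (simp add: a_def tan_def * power2_eq_square)
      finally show ?thesis .
    qed
    have eq: "rotation t p = (let q = (fst p + a * snd p, snd p);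
                r = (fst q, snd q + sin t * fst q) in (fst r + a * snd r, snd r))" for p
    proof -
      obtain x y where p: "p = (x, y)" by force
      have "(x + a * y) + a * (y + sin t * (x + a * y)) = x * (1 + a * sin t) + y * (2 * a + a * (a * sin t))"
        by (simp add: algebra_simps)
      also have "\<dots> = x * (1 + a * sin t) + y * (- sin t)" by (simp only: aa)
      also have "\<dots> = x * cos t - y * sin t" unfolding as by simp
      finally have 1: "(x + a * y) + a * (y + sin t * (x + a * y)) = x * cos t - y * sin t" .
      have "y + sin t * (x + a * y) = x * sin t + y * (1 + a * sin t)" by (simp add: algebra_simps)
      also have "\<dots> = x * sin t + y * cos t" unfolding as by simp
      finally show ?thesis using 1 by (simp add: p rotation_def Let_def)
    qed
    have "lborel = distr (distr (distr lborel borel (\<lambda>p::real \<times> real. (fst p + a * snd p, snd p)))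
        borel (\<lambda>p::real \<times> real. (fst p, snd p + sin t * fst p))) borel (\<lambda>p::real \<times> real. (fst p + a * snd p, snd p))"
      by (simp add: distr_lborel_shear_fst distr_lborel_shear_snd)
    also have "\<dots> = distr lborel borel (rotation t)"
      by (subst distr_distr_distr) (use m1 m2 in \<open>auto simp: eq[abs_def] Let_def\<close>)
    finally show ?thesis by simp
  qed
  show ?thesis
  proof (cases "cos (t / 2) = 0")
    case True
    \<comment> \<open>The half turn is the square of the rotation by t / 2, a quarter turn, to which
      \<open>main\<close> applies.\<close>
    have "cos (t / 2 / 2) \<noteq> 0"
    proof
      assume "cos (t / 2 / 2) = 0"
      then have "cos (2 * (t / 2 / 2)) = -1" by (subst cos_double_cos) simp
      with True show False by simp
    qed
    from main[OF this] have h: "distr lborel borel (rotation (t / 2)) = lborel" .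
    have "lborel = distr (distr lborel borel (rotation (t / 2))) borel (rotation (t / 2))"
      by (simp add: h)
    also have "\<dots> = distr lborel borel (rotation t)"
      by (subst distr_distr) (auto simp: comp_def rotation_add)
    finally show ?thesis by simp
  qed (rule main)
qed

lemma integral_rotation:
  fixes g :: "real \<times> real \<Rightarrow> complex"
  assumes [measurable]: "g \<in> borel_measurable borel"
  shows "(\<integral>p. g (rotation t p) \<partial>lborel) = (\<integral>p. g p \<partial>lborel)"
  by (subst (2) distr_lborel_rotation[of t, symmetric]) (simp add: integral_distr)

section \<open>Lebesgue measure on the disk seen through the radius\<close>

text \<open>Both measures are finite on the rays \<open>{x<..}\<close>, so agreement there suffices.
  On the left such a ray gives the area pi (1 - x^2) of an annulus, known from the volume of balls;
  no change to polar coordinates is involved.\<close>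

lemma distr_norm_ball:
  "distr (restrict_space lborel (ball (0::real \<times> real) 1)) borel norm
     = density lborel (\<lambda>r. ennreal (2 * pi * r * indicator {0..1} r))" (is "?M = ?N")
proof (rule measure_eqI_lessThan)
  have m: "norm \<in> restrict_space lborel (ball (0::real \<times> real) 1) \<rightarrow>\<^sub>M borel"
    by (rule measurable_restrict_space1) simp
  have vol: "emeasure lborel (ball (0::real \<times> real) 1 - cball 0 x) = ennreal (pi * (1 - x\<^sup>2))"
    if "0 \<le> x" "x \<le> 1" for x
  proof (cases "x = 1")
    case False
    with that have sub: "cball (0::real \<times> real) x \<subseteq> ball 0 1" by auto
    have "emeasure lborel (ball (0::real \<times> real) 1 - cball 0 x)
        = emeasure lborel (ball (0::real \<times> real) 1) - emeasure lborel (cball (0::real \<times> real) x)"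
      using sub that by (intro emeasure_Diff) (auto simp: emeasure_cball)
    also have "\<dots> = ennreal (pi * (1 - x\<^sup>2))"
      using that by (simp add: emeasure_cball emeasure_ball unit_ball_vol_2 ennreal_minus algebra_simps power2_eq_square)
    finally show ?thesis .
  next
    case True
    then have "ball (0::real \<times> real) 1 - cball 0 x = {}" by auto
    then show ?thesis using True by (simp only: emeasure_empty) simp
  qed
  have M: "emeasure ?M {x<..} = emeasure lborel (ball (0::real \<times> real) 1 - cball 0 x)" for x
  proof -
    have "emeasure ?M {x<..} = emeasure (restrict_space lborel (ball (0::real \<times> real) 1)) 
        (ball (0::real \<times> real) 1 - cball 0 x)"
      using m by (subst emeasure_distr) (auto simp: space_restrict_space intro!: arg_cong2[where f=emeasure])
    then show ?thesis by (subst (asm) emeasure_restrict_space) auto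
  qed
  have N: "emeasure ?N {x<..} = (\<integral>\<^sup>+r. ennreal (2 * pi * r) * indicator {max 0 x..1} r \<partial>lborel)" for x
  proof -
    have "emeasure ?N {x<..} = (\<integral>\<^sup>+r. ennreal (2 * pi * r * indicator {0..1} r) * indicator {x<..} r \<partial>lborel)"
      by (subst emeasure_density) auto
    also have "\<dots> = (\<integral>\<^sup>+r. ennreal (2 * pi * r) * indicator {max 0 x..1} r \<partial>lborel)"
      \<comment> \<open>The two domains of integration may differ in the single point
        \<open>x\<close>.\<close>
      using AE_lborel_singleton[of x]
      by (intro nn_integral_cong_AE) (auto split: split_indicator elim!: eventually_mono)
    finally show ?thesis .
  qed
  have FTC: "(\<integral>\<^sup>+r. ennreal (2 * pi * r) * indicator {a..1} r \<partial>lborel) = ennreal (pi * (1 - a\<^sup>2))"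
    if "0 \<le> a" "a \<le> 1" for a
  proof -
    have "(\<integral>\<^sup>+r. ennreal (2 * pi * r) * indicator {a..1} r \<partial>lborel) = ennreal (pi * 1\<^sup>2 - pi * a\<^sup>2)"
      using that
      by (intro nn_integral_FTC_Icc[where F="\<lambda>r. pi * r\<^sup>2"]) (auto intro!: derivative_eq_intros)
    then show ?thesis by (simp add: algebra_simps)
  qed
  show eq: "emeasure ?M {x<..} = emeasure ?N {x<..}" for x
  proof -
    consider "x < 0" | "0 \<le> x" "x \<le> 1" | "x > 1" by linarith
    then show ?thesis
    proof cases
      case 1
      then show ?thesis unfolding M N using FTC[of 0]
        by (simp add: emeasure_ball unit_ball_vol_2 max_def)
    next
      case 2
      then show ?thesis unfolding M N using FTC[of x] vol[of x] by (simp add: max_def)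
    next
      case 3
      then have "ball (0::real \<times> real) 1 - cball 0 x = {}" by auto
      moreover from 3 have "{max 0 x..1} = {}" by auto
      ultimately show ?thesis unfolding M N by (simp only: emeasure_empty) simp
    qed
  qed
  show "emeasure ?M {x<..} < \<infinity>" for x
  proof -
    have "emeasure ?M {x<..} \<le> emeasure lborel (ball (0::real \<times> real) 1)"
      unfolding M by (intro emeasure_mono) auto
    also have "\<dots> < \<infinity>" by (simp add: emeasure_ball)
    finally show ?thesis .
  qed
qed auto

lemma integral_radial:
  fixes h :: "real \<Rightarrow> complex"
  assumes [measurable]: "h \<in> borel_measurable borel"
  shows "(\<integral>p. indicator (ball (0::real \<times> real) 1) p *\<^sub>R h (norm p) \<partial>lborel)
       = (\<integral>r. indicator {0..1} r *\<^sub>R (of_real (2 * pi * r) * h r) \<partial>lborel)"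
proof -
  have "(\<integral>p. indicator (ball (0::real \<times> real) 1) p *\<^sub>R h (norm p) \<partial>lborel)
      = (\<integral>p. h (norm p) \<partial>restrict_space lborel (ball (0::real \<times> real) 1))"
    by (subst integral_restrict_space) (auto simp: set_lebesgue_integral_def)
  also have "\<dots> = (\<integral>r. h r \<partial>distr (restrict_space lborel (ball (0::real \<times> real) 1)) borel norm)"
    by (subst integral_distr) (auto intro!: measurable_restrict_space1)
  also have "\<dots> = (\<integral>r. (2 * pi * r * indicator {0..1} r) *\<^sub>R h r \<partial>lborel)"
    unfolding distr_norm_ball by (subst integral_density) (auto split: split_indicator)
  also have "\<dots> = (\<integral>r. indicator {0..1} r *\<^sub>R (of_real (2 * pi * r) * h r) \<partial>lborel)"
    by (intro Bochner_Integration.integral_cong) (auto split: split_indicator simp: scaleR_conv_of_real)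
  finally show ?thesis .
qed

section \<open>Bessel functions and their zeros\<close>

text \<open>With s = x^2 / 4 this is J_M(x) / (x/2)^M, an entire function of s (the Bessel-Clifford
  function at -s). It is polymorphic because zeros are produced over the reals by Rolle's theorem
  but shown to be isolated over the complex numbers.\<close>

definition bessel_series :: "nat \<Rightarrow> 'a \<Rightarrow> 'a::{real_normed_field,banach}" where
  "bessel_series M s = (\<Sum>k. (-1) ^ k / (fact k * fact (k + M)) * s ^ k)"

lemma summable_bessel_series:
  "summable (\<lambda>k. (-1) ^ k / (fact k * fact (k + M)) * (s::'a::{real_normed_field,banach}) ^ k)"
proof (rule summable_comparison_test')
  show "summable (\<lambda>k. norm s ^ k /\<^sub>R fact k)"
    by (rule summable_exp_generic)
  show "norm ((-1) ^ k / (fact k * fact (k + M)) * s ^ k) \<le> norm s ^ k /\<^sub>R fact k" for k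
  proof -
    have "norm s ^ k / (fact k * fact (k + M)) \<le> norm s ^ k / (fact k * 1)"
      by (intro divide_left_mono mult_left_mono) (auto simp: fact_ge_1)
    then show ?thesis by (simp add: norm_mult norm_divide norm_power field_simps)
  qed
qed

text \<open>The factor k + 1 produced by differentiation cancels against the factorial, so in the
  variable s a derivative merely raises the order. This is the form that Rolle's theorem
  needs.\<close>

lemma DERIV_bessel_series:
  "(bessel_series M has_field_derivative - bessel_series (Suc M) s) (at (s::'a::{real_normed_field,banach}))"
proof -
  have "diffs (\<lambda>k. (-1) ^ k / (fact k * fact (k + M))) = (\<lambda>k. - ((-1) ^ k / (fact k * fact (k + Suc M))) :: 'a)"
  proof
    fix k
    have "(1 + of_nat k :: 'a) \<noteq> 0" by (metis of_nat_Suc of_nat_neq_0)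
    then show "diffs (\<lambda>k. (-1) ^ k / (fact k * fact (k + M))) k = (- ((-1) ^ k / (fact k * fact (k + Suc M))) :: 'a)"
      unfolding diffs_def fact_Suc by simp
  qed
  moreover have "((\<lambda>s. \<Sum>k. (-1) ^ k / (fact k * fact (k + M)) * s ^ k) has_field_derivative
     (\<Sum>k. diffs (\<lambda>k. (-1) ^ k / (fact k * fact (k + M))) k * s ^ k)) (at s)"
    by (intro termdiffs_strong_converges_everywhere summable_bessel_series)
  ultimately have "((\<lambda>s. \<Sum>k. (-1) ^ k / (fact k * fact (k + M)) * s ^ k) has_field_derivative
     (\<Sum>k. - ((-1) ^ k / (fact k * fact (k + Suc M)) * s ^ k))) (at s)"
    by simp
  then show ?thesis
    unfolding bessel_series_def by (simp only: suminf_minus[OF summable_bessel_series])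
qed

lemmas DERIV_bessel_series_chain [derivative_intros] = DERIV_chain2[OF DERIV_bessel_series]

text \<open>The three-term recurrence of the Bessel functions, freed of the powers of x, by
  comparison of coefficients.\<close>

lemma bessel_series_recurrence:
  "s * bessel_series (Suc (Suc M)) s = of_nat (Suc M) * bessel_series (Suc M) s - bessel_series M (s::'a::{real_normed_field,banach})"
proof -
  let ?c = "\<lambda>M k. (-1) ^ k / (fact k * fact (k + M)) :: 'a"
  \<comment> \<open>The coefficient of s^k for k = j + 1, in abstract form: A = k, B = M + 1, N = k
    + M + 1, f = j!, F = (k + M)! and e = (-1)^j.\<close>
  have field_id: "(-1 * e) / ((A * f) * (N * F)) * B - (-1 * e) / ((A * f) * F) = e / (f * (N * F))"
    if "A \<noteq> 0" "N \<noteq> 0" "F \<noteq> 0" "f \<noteq> 0" "N = A + B" for A N F f B e :: 'a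
  proof -
    have "(-1 * e) / ((A * f) * (N * F)) * B = (-1 * e) * B / ((A * f) * (N * F))" by simp
    moreover have "(-1 * e) / ((A * f) * F) = (-1 * e) * N / ((A * f) * (N * F))" using that(2) by simp
    moreover have "e / (f * (N * F)) = e * A / ((A * f) * (N * F))" using that(1) by simp
    moreover have "(-1 * e) * B - (-1 * e) * N = e * A" by (simp add: that(5) algebra_simps)
    ultimately show ?thesis by (simp only: diff_divide_distrib[symmetric])
  qed
  have 1: "(\<lambda>k. ?c M k * s ^ k) sums bessel_series M s" for M
    unfolding bessel_series_def by (intro summable_sums summable_bessel_series)
  have A: "(\<lambda>k. of_nat (Suc M) * (?c (Suc M) k * s ^ k) - ?c M k * s ^ k) sums
        (of_nat (Suc M) * bessel_series (Suc M) s - bessel_series M s)"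
    by (intro sums_diff sums_mult 1)
  \<comment> \<open>The factor s on the left of the recurrence shifts the index by one. The constant
    term vanishes because (M + 1) / (M + 1)! = 1 / M!.\<close>
  have B: "of_nat (Suc M) * (?c (Suc M) k * s ^ k) - ?c M k * s ^ k = 
      (if k = 0 then 0 else s * (?c (Suc (Suc M)) (k - 1) * s ^ (k - 1)))" for k
  proof (cases k)
    case 0
    have "(of_nat (Suc M) :: 'a) \<noteq> 0" by (metis of_nat_neq_0)
    then show ?thesis using 0 by (simp add: fact_Suc del: of_nat_Suc)
  next
    case (Suc j)
    define F where "F = (fact (j + Suc M) :: 'a)"
    have F: "F \<noteq> 0" by (simp only: F_def fact_nonzero not_False_eq_True)
    have n1: "(of_nat (Suc j) :: 'a) \<noteq> 0" by (metis of_nat_neq_0)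
    have n2: "(of_nat (Suc (Suc (j + M))) :: 'a) \<noteq> 0" by (metis of_nat_neq_0)
    have f1: "fact (k + Suc M) = of_nat (Suc (Suc (j + M))) * F" 
      and f2: "fact (k + M) = F" and f3: "fact (j + Suc (Suc M)) = of_nat (Suc (Suc (j + M))) * F"
      and f4: "fact k = of_nat (Suc j) * (fact j :: 'a)"
      unfolding F_def Suc by (simp_all add: algebra_simps)
    have n: "of_nat (Suc (Suc (j + M))) = (of_nat (Suc j) + of_nat (Suc M) :: 'a)" by simp
    have "?c (Suc M) k * of_nat (Suc M) - ?c M k = ?c (Suc (Suc M)) j"
      unfolding f1 f2 f3 f4 unfolding Suc power_Suc times_divide_eq_left
      using field_id[OF n1 n2 F fact_nonzero[of j] n, of "(-1) ^ j"] by (simp only: times_divide_eq_left)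
    then have "(of_nat (Suc M) * ?c (Suc M) k - ?c M k) * s ^ k = s * (?c (Suc (Suc M)) j * s ^ j)"
      by (simp add: Suc mult_ac)
    then show ?thesis by (simp only: Suc left_diff_distrib mult.assoc) simp
  qed
  have "(\<lambda>k. s * (?c (Suc (Suc M)) k * s ^ k)) sums (s * bessel_series (Suc (Suc M)) s)"
    by (intro sums_mult 1)
  then have "(\<lambda>k. if k = 0 then 0 else s * (?c (Suc (Suc M)) (k - 1) * s ^ (k - 1))) sums
     (s * bessel_series (Suc (Suc M)) s)"
    using sums_Suc[where f="\<lambda>k. if k = 0 then 0 else s * (?c (Suc (Suc M)) (k - 1) * s ^ (k - 1))"]
    by simp
  then show ?thesis using A unfolding B by (rule sums_unique2)
qed

lemma bessel_series_0: "bessel_series M 0 = (1 / fact M :: 'a::{real_normed_field,banach})"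
proof -
  have "(\<lambda>k. (-1) ^ k / (fact k * fact (k + M)) * (0::'a) ^ k) sums ((-1) ^ 0 / (fact 0 * fact (0 + M)) * 0 ^ 0)"
    by (rule sums_single[where i=0 and f="\<lambda>k. (-1) ^ k / (fact k * fact (k + M)) * (0::'a) ^ k", THEN sums_cong[THEN iffD1, rotated]])
       simp
  then show ?thesis unfolding bessel_series_def by (simp add: sums_iff)
qed

lemma bessel_series_of_real:
  "bessel_series M (of_real s) = (of_real (bessel_series M s) :: 'a::{real_normed_field,banach})"
proof -
  have "of_real (bessel_series M s) = (\<Sum>k. of_real ((-1) ^ k / (fact k * fact (k + M)) * s ^ k) :: 'a)"
    unfolding bessel_series_def by (intro suminf_of_real summable_bessel_series)
  then show ?thesis by (simp add: bessel_series_def)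
qed

section \<open>Bessel functions of natural order and their positive zeros\<close>

text \<open>J_M for M \<ge> 0 without \<open>rGamma\<close> and \<open>powi\<close>;
  \<open>bessel_J_eq\<close> reduces every integer order to it.\<close>

definition bessel_nat :: "nat \<Rightarrow> real \<Rightarrow> real" where
  "bessel_nat M x = (x / 2) ^ M * bessel_series M (x\<^sup>2 / 4)"

lemma bessel_nat_recurrence:
  assumes "x \<noteq> 0"
  shows "bessel_nat (Suc (Suc M)) x = 2 * real (Suc M) / x * bessel_nat (Suc M) x - bessel_nat M x"
proof -
  have "bessel_nat (Suc (Suc M)) x = (x / 2) ^ M * ((x\<^sup>2 / 4) * bessel_series (Suc (Suc M)) (x\<^sup>2 / 4))"
    by (simp add: bessel_nat_def power2_eq_square)
  also have "\<dots> = (x / 2) ^ M * (real (Suc M) * bessel_series (Suc M) (x\<^sup>2 / 4) - bessel_series M (x\<^sup>2 / 4))"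
    by (simp only: bessel_series_recurrence)
  moreover have "2 * real (Suc M) / x * bessel_nat (Suc M) x = (x / 2) ^ M * (real (Suc M) * bessel_series (Suc M) (x\<^sup>2 / 4))"
    using assms by (simp add: bessel_nat_def)
  ultimately show ?thesis by (simp only: bessel_nat_def[of M] right_diff_distrib)
qed

lemma DERIV_bessel_nat:
  assumes "x \<noteq> 0"
  shows "(bessel_nat M has_real_derivative real M / x * bessel_nat M x - bessel_nat (Suc M) x) (at x)"
proof -
  have 1: "((\<lambda>x. (x / 2) ^ M) has_real_derivative real M / x * (x / 2) ^ M) (at x)"
  proof -
    have "((\<lambda>x. (x / 2) ^ M) has_real_derivative real M * (x / 2) ^ (M - 1) * (1 / 2)) (at x)"
      by (auto intro!: derivative_eq_intros)
    moreover have "real M * (x / 2) ^ (M - 1) * (1 / 2) = real M / x * (x / 2) ^ M"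
      using assms by (cases M) auto
    ultimately show ?thesis by simp
  qed
  have 2: "((\<lambda>x. bessel_series M (x\<^sup>2 / 4)) has_real_derivative - bessel_series (Suc M) (x\<^sup>2 / 4) * (x / 2)) (at x)"
    by (auto intro!: derivative_eq_intros)
  have "((\<lambda>x. (x / 2) ^ M * bessel_series M (x\<^sup>2 / 4)) has_real_derivative
    real M / x * bessel_nat M x - bessel_nat (Suc M) x) (at x)"
    using DERIV_mult[OF 1 2] by (simp add: bessel_nat_def algebra_simps)
  then show ?thesis unfolding bessel_nat_def[abs_def] by simp
qed

text \<open>Together with \<open>DERIV_bessel_nat\<close> this makes J_M and J_(M+1) a closed
  first-order system, so the Sturm and Lommel computations can be differentiated without second
  derivatives.\<close>

lemma DERIV_bessel_nat_Suc:
  assumes "x \<noteq> 0"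
  shows "(bessel_nat (Suc M) has_real_derivative bessel_nat M x - real (Suc M) / x * bessel_nat (Suc M) x) (at x)"
  using DERIV_bessel_nat[OF assms, of "Suc M"] bessel_nat_recurrence[OF assms, of M]
  by (simp add: add_divide_distrib algebra_simps)

lemma continuous_on_bessel_nat [continuous_intros]:
  assumes "continuous_on A f"
  shows "continuous_on A (\<lambda>x. bessel_nat M (f x))"
proof -
  have "isCont (\<lambda>x. bessel_series M (x\<^sup>2 / 4)) x" for x :: real
    by (rule DERIV_isCont) (auto intro!: derivative_eq_intros)
  then have "continuous_on UNIV (\<lambda>x::real. bessel_series M (x\<^sup>2 / 4))"
    by (simp add: continuous_at_imp_continuous_on)
  then have "continuous_on UNIV (bessel_nat M)"
    unfolding bessel_nat_def[abs_def] by (intro continuous_on_mult continuous_intros) auto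
  from continuous_on_compose2[OF this assms] show ?thesis by simp
qed

lemma borel_measurable_bessel_nat [measurable]: "bessel_nat M \<in> borel_measurable borel"
  by (intro borel_measurable_continuous_onI continuous_intros)

text \<open>Sturm comparison with the sine: \<open>u = \<surd>x J\<^sub>0\<close> solves \<open>u'' + (1 + 1 / (4x\<^sup>2)) u = 0\<close>.\<close>

lemma bessel_nat_0_zero_in_interval:
  assumes "a > 0"
  shows "\<exists>x\<in>{a..a + pi}. bessel_nat 0 x = 0"
proof (rule ccontr)
  assume nz: "\<not> ?thesis"
  define \<sigma> where "\<sigma> = sgn (bessel_nat 0 a)"
  have pos: "\<sigma> * bessel_nat 0 x > 0" if "x \<in> {a..a + pi}" for x
  proof (rule ccontr)
    assume neg: "\<not> \<sigma> * bessel_nat 0 x > 0"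
    have "bessel_nat 0 a \<noteq> 0" using nz by auto
    then have pa: "\<sigma> * bessel_nat 0 a > 0" by (auto simp: \<sigma>_def sgn_if)
    have "continuous_on {a..x} (\<lambda>x. \<sigma> * bessel_nat 0 x)" by (intro continuous_intros)
    with pa neg that obtain y where "a \<le> y" "y \<le> x" "\<sigma> * bessel_nat 0 y = 0"
      using IVT2'[of "\<lambda>x. \<sigma> * bessel_nat 0 x" x 0 a] by auto
    with nz that \<open>bessel_nat 0 a \<noteq> 0\<close> show False by (auto simp: \<sigma>_def sgn_if split: if_splits)
  qed
  define u where "u x = \<sigma> * (sqrt x * bessel_nat 0 x)" for x
  define v where "v x = \<sigma> * (bessel_nat 0 x / (2 * sqrt x) - sqrt x * bessel_nat 1 x)" for x
  \<comment> \<open>Since v = u', this is the Wronskian of u and sin (x - a); its derivative is (u''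
    + u) sin (x - a).\<close>
  define W where "W x = v x * sin (x - a) - u x * cos (x - a)" for x
  have dW: "(W has_real_derivative - (u x / (4 * x\<^sup>2) * sin (x - a))) (at x)" if "x > 0" for x
  proof -
    define r where "r = sqrt x"
    have r: "r > 0" "x = r\<^sup>2" using that by (simp_all add: r_def)
    have d0: "(bessel_nat 0 has_real_derivative - bessel_nat 1 x) (at x)"
      using DERIV_bessel_nat[of x 0] that by simp
    have d1: "(bessel_nat 1 has_real_derivative bessel_nat 0 x - bessel_nat 1 x / x) (at x)"
      using DERIV_bessel_nat_Suc[of x 0] that by simp
    have du: "(u has_real_derivative v x) (at x)"
      unfolding u_def[abs_def] v_def using that
      by (auto intro!: derivative_eq_intros d0 simp: field_simps)
    have dv: "(v has_real_derivative - u x - u x / (4 * x\<^sup>2)) (at x)"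
    proof -
      have ds: "(sqrt has_real_derivative 1 / (2 * r)) (at x)"
        using DERIV_real_sqrt[OF that] by (simp add: r_def field_simps)
      have e: "((- bessel_nat 1 x * (2 * r) - bessel_nat 0 x * (2 * (1 / (2 * r)))) / ((2 * r) * (2 * r))
               - (1 / (2 * r) * bessel_nat 1 x + (bessel_nat 0 x - bessel_nat 1 x / r\<^sup>2) * r))
               = - (r * bessel_nat 0 x) - r * bessel_nat 0 x / (4 * (r\<^sup>2)\<^sup>2)"
      proof -
        \<comment> \<open>Replacing 1 / r by a variable with r i = 1 turns the claim into a
          polynomial identity.\<close>
        define i where "i = inverse r"
        have ri: "r * i = 1" using r(1) by (simp add: i_def)
        have "((- bessel_nat 1 x * (2 * r) - bessel_nat 0 x * i) * (i * i / 4)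
               - (i / 2 * bessel_nat 1 x + (bessel_nat 0 x - bessel_nat 1 x * (i * i)) * r))
               = - (r * bessel_nat 0 x) - r * bessel_nat 0 x * (i * i * i * i / 4)"
          using ri by algebra
        moreover have "2 * (1 / (2 * r)) = i" "1 / (2 * r) = i / 2" "y / ((2 * r) * (2 * r)) = y * (i * i / 4)"
            "y / r\<^sup>2 = y * (i * i)" "y / (4 * (r\<^sup>2)\<^sup>2) = y * (i * i * i * i / 4)" for y
          using r(1) by (simp_all add: i_def field_simps power2_eq_square)
        ultimately show ?thesis by (simp only:)
      qed
      have "((\<lambda>x. bessel_nat 0 x / (2 * sqrt x) - sqrt x * bessel_nat 1 x) has_real_derivative
          ((- bessel_nat 1 x * (2 * r) - bessel_nat 0 x * (2 * (1 / (2 * r)))) / ((2 * r) * (2 * r))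
               - (1 / (2 * r) * bessel_nat 1 x + (bessel_nat 0 x - bessel_nat 1 x / r\<^sup>2) * r))) (at x)"
        using DERIV_diff[OF DERIV_divide[OF d0 DERIV_cmult[OF ds, of 2]] DERIV_mult[OF ds d1]] r
        by (simp add: r_def[symmetric])
      from DERIV_cmult[OF this[unfolded e], of \<sigma>] show ?thesis
        unfolding v_def[abs_def] u_def r_def[symmetric] r(2)[symmetric]
        by (rule DERIV_cong) (simp add: algebra_simps)
    qed
    show ?thesis unfolding W_def[abs_def]
      by (auto intro!: derivative_eq_intros du dv simp: algebra_simps)
  qed
  have upos: "u x > 0" if "x \<in> {a..a + pi}" for x
  proof -
    have "sqrt x * (\<sigma> * bessel_nat 0 x) > 0" using assms that by (intro mult_pos_pos[OF _ pos]) auto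
    then show ?thesis by (simp add: u_def mult_ac)
  qed
  \<comment> \<open>The sine vanishes at both ends, so \<open>W a = - u a\<close> and
    \<open>W (a + pi) = u (a + pi)\<close>. Monotonicity of \<open>W\<close> then contradicts the
    positivity of \<open>u\<close>.\<close>
  have "W (a + pi) \<le> W a"
  proof (rule DERIV_nonpos_imp_nonincreasing[of a "a + pi" W])
    fix x assume x: "a \<le> x" "x \<le> a + pi"
    have "u x > 0" using upos x by simp
    moreover have "sin (x - a) \<ge> 0" using x by (intro sin_ge_zero) auto
    ultimately have "- (u x / (4 * x\<^sup>2) * sin (x - a)) \<le> 0" by simp
    with dW[of x] x assms show "\<exists>y. (W has_real_derivative y) (at x) \<and> y \<le> 0" by auto
  qed simp
  moreover have "u a > 0" "u (a + pi) > 0"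
    by (rule upos, simp)+
  ultimately show False by (simp add: W_def)
qed

text \<open>The zeros of \<open>J\<^sub>0\<close> are passed on to all orders by Rolle's theorem.\<close>

lemma bessel_series_zeros_unbounded: "\<exists>s>a. bessel_series M (s::real) = 0"
proof (induction M arbitrary: a)
  case 0
  \<comment> \<open>From x \<ge> 2 + 4 \<bar>a\<bar> follows x^2 / 4 \<ge> 1 + 2 \<bar>a\<bar> >
    a.\<close>
  obtain x where x: "x \<ge> 2 + 4 * \<bar>a\<bar>" "bessel_nat 0 x = 0"
    using bessel_nat_0_zero_in_interval[of "2 + 4 * \<bar>a\<bar>"] by fastforce
  have "x * x \<ge> (2 + 4 * \<bar>a\<bar>) * 2" using x by (intro mult_mono) auto
  then have "x\<^sup>2 / 4 > a" by (simp add: power2_eq_square)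
  with x show ?case by (intro exI[of _ "x\<^sup>2 / 4"]) (auto simp: bessel_nat_def)
next
  case (Suc M)
  obtain s1 where s1: "s1 > a" "bessel_series M s1 = 0" using Suc by blast
  obtain s2 where s2: "s2 > s1" "bessel_series M s2 = 0" using Suc by blast
  have "\<exists>z>s1. z < s2 \<and> (*) (- bessel_series (Suc M) z) = (\<lambda>v. 0 :: real)"
    using s1 s2 DERIV_bessel_series[where 'a=real]
    by (intro Rolle_deriv[where f="bessel_series M" and f'="\<lambda>z. (*) (- bessel_series (Suc M) z)"])
       (auto simp: has_field_derivative_def intro!: DERIV_continuous_on[OF has_field_derivative_at_within])
  then obtain z where "z > s1" "(*) (- bessel_series (Suc M) z) 1 = (0 :: real)" by metis
  with s1 show ?case by (auto intro!: exI[of _ z])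
qed

text \<open>The complex series is entire and not constant, since it is 1 / M! at 0 and has a zero;
  such a function has only finitely many zeros in a compact set.\<close>

lemma finite_bessel_series_zeros: "finite {s\<in>{0..R}. bessel_series M (s::real) = 0}"
proof -
  have "finite {z \<in> of_real ` {0..R}. bessel_series M z = (0::complex)}"
  proof (rule holomorphic_compact_finite_zeros[where S=UNIV])
    show "bessel_series M holomorphic_on (UNIV :: complex set)"
      unfolding holomorphic_on_def field_differentiable_def using DERIV_bessel_series by blast
    show "compact (complex_of_real ` {0..R})"
      by (intro compact_continuous_image continuous_intros compact_Icc)
    show "\<not> (bessel_series M :: complex \<Rightarrow> complex) constant_on UNIV"
    proof
      assume "(bessel_series M :: complex \<Rightarrow> complex) constant_on UNIV"
      then obtain c where c: "\<And>z::complex. bessel_series M z = c" by (auto simp: constant_on_def)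
      obtain s :: real where "bessel_series M s = 0" using bessel_series_zeros_unbounded by blast
      then have "c = 0" using c[of "of_real s"] bessel_series_of_real[of M s, where 'a=complex] by simp
      moreover have "c \<noteq> 0" using c[of 0, symmetric] by (simp add: bessel_series_0)
      ultimately show False by simp
    qed
  qed auto
  then have "finite (Re ` {z \<in> of_real ` {0..R}. bessel_series M z = (0::complex)})" by simp
  moreover have "{s\<in>{0..R}. bessel_series M (s::real) = 0} \<subseteq> Re ` {z \<in> of_real ` {0..R}. bessel_series M z = (0::complex)}"
    by (force simp: bessel_series_of_real image_iff)
  ultimately show ?thesis by (rule finite_subset[rotated])
qed

lemma bessel_nat_zero_iff: "x > 0 \<Longrightarrow> bessel_nat M x = 0 \<longleftrightarrow> bessel_series M (x\<^sup>2 / 4) = 0"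
  by (simp add: bessel_nat_def)

lemma finite_bessel_nat_zeros: "finite {x. 0 < x \<and> x \<le> R \<and> bessel_nat M x = 0}"
proof -
  have "{x. 0 < x \<and> x \<le> R \<and> bessel_nat M x = 0} \<subseteq> (\<lambda>s. 2 * sqrt s) ` {s\<in>{0..R\<^sup>2 / 4}. bessel_series M s = 0}"
  proof
    fix x assume x: "x \<in> {x. 0 < x \<and> x \<le> R \<and> bessel_nat M x = 0}"
    then have "x\<^sup>2 \<le> R\<^sup>2" by (intro power_mono) auto
    moreover have "x = 2 * sqrt (x\<^sup>2 / 4)" using x by (simp add: real_sqrt_divide)
    ultimately show "x \<in> (\<lambda>s. 2 * sqrt s) ` {s\<in>{0..R\<^sup>2 / 4}. bessel_series M s = 0}"
      using x by (intro image_eqI[of _ _ "x\<^sup>2 / 4"]) (auto simp: bessel_nat_zero_iff)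
  qed
  then show ?thesis by (rule finite_subset) (intro finite_imageI finite_bessel_series_zeros)
qed

lemma bessel_nat_zeros_unbounded: "\<exists>x>a. 0 < x \<and> bessel_nat M x = 0"
proof -
  obtain s :: real where s: "s > a\<^sup>2 / 4" "bessel_series M s = 0"
    using bessel_series_zeros_unbounded by blast
  then have "s > 0" by (smt (verit) zero_le_power2 divide_nonneg_nonneg)
  have "sqrt (a\<^sup>2) < sqrt (4 * s)" using s by (intro real_sqrt_less_mono) simp
  then have "a < 2 * sqrt s" by (simp add: real_sqrt_mult)
  with s \<open>s > 0\<close> show ?thesis
    by (intro exI[of _ "2 * sqrt s"]) (auto simp: bessel_nat_def power_mult_distrib)
qed

section \<open>The n-th positive zero and integer orders\<close>

text \<open>Gives the definite description in \<open>bessel_zero\<close> its meaning. Passing to the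
  next element of \<open>Z\<close> raises the count by exactly one, so every n \<ge> 1 is attained;
  the count grows strictly along \<open>Z\<close>, so it is attained once.\<close>

lemma ex1_nth_element:
  fixes Z :: "real set"
  assumes fin: "\<And>a. finite {x\<in>Z. x \<le> a}" and unb: "\<And>a. \<exists>x\<in>Z. x > a" and n: "n \<ge> 1"
  shows "\<exists>!z. z \<in> Z \<and> card {x\<in>Z. x \<le> z} = n"
proof -
  have next_el: "\<exists>z\<in>Z. a < z \<and> {x\<in>Z. x \<le> z} = insert z {x\<in>Z. x \<le> a}" for a
  proof -
    obtain w where w: "w \<in> Z" "w > a" using unb by blast
    define S where "S = {x\<in>Z. x \<le> w} \<inter> {a<..}"
    have S: "finite S" "S \<noteq> {}" using fin[of w] w by (auto simp: S_def)
    have min: "Min S \<in> S" "\<And>x. x \<in> S \<Longrightarrow> Min S \<le> x" using S by auto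
    show ?thesis
    proof (intro bexI[of _ "Min S"] conjI)
      show "Min S \<in> Z" "a < Min S" using min(1) by (auto simp: S_def)
      show "{x\<in>Z. x \<le> Min S} = insert (Min S) {x\<in>Z. x \<le> a}"
      proof (intro equalityI subsetI)
        fix x assume x: "x \<in> {x\<in>Z. x \<le> Min S}"
        show "x \<in> insert (Min S) {x\<in>Z. x \<le> a}"
        proof (cases "x \<le> a")
          case False
          then have "x \<in> S" using x min(1) by (auto simp: S_def)
          from min(2)[OF this] x show ?thesis by auto
        qed (use x in auto)
      qed (use min(1) in \<open>auto simp: S_def\<close>)
    qed
  qed
  have "\<exists>z\<in>Z. card {x\<in>Z. x \<le> z} = n" using n
  proof (induction n rule: dec_induct)
    case base
    obtain w where w: "w \<in> Z" using unb by blast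
    \<comment> \<open>A point below all of \<open>Z\<close>, so that its successor in
      \<open>Z\<close> is the first element.\<close>
    define a where "a = Min {x\<in>Z. x \<le> w} - 1"
    have "{x\<in>Z. x \<le> a} = {}"
    proof (rule ccontr)
      assume "{x\<in>Z. x \<le> a} \<noteq> {}"
      then obtain x where x: "x \<in> Z" "x \<le> a" by auto
      have "a \<le> w" using Min_le[OF fin[of w], of w] w by (simp add: a_def)
      with x have "Min {x\<in>Z. x \<le> w} \<le> x" by (intro Min_le fin) auto
      with x show False by (simp add: a_def)
    qed
    with next_el[of a] obtain z where "z \<in> Z" "{x\<in>Z. x \<le> z} = {z}" by auto
    then show ?case by (intro bexI[of _ z]) auto
  next
    case (step n)
    then obtain z where z: "z \<in> Z" "card {x\<in>Z. x \<le> z} = n" by blast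
    obtain z' where "z' \<in> Z" "z < z'" "{x\<in>Z. x \<le> z'} = insert z' {x\<in>Z. x \<le> z}" using next_el by blast
    with z fin[of z] show ?case by (intro bexI[of _ z']) auto
  qed
  moreover have "z = z'" if "z \<in> Z" "z' \<in> Z" "card {x\<in>Z. x \<le> z} = card {x\<in>Z. x \<le> z'}" for z z'
  proof -
    have "\<not> z < z'" if "z \<in> Z" "z' \<in> Z" "card {x\<in>Z. x \<le> z} = card {x\<in>Z. x \<le> z'}" for z z'
    proof
      assume "z < z'"
      then have "{x\<in>Z. x \<le> z} \<subset> {x\<in>Z. x \<le> z'}" using that by force
      from psubset_card_mono[OF fin this] that show False by simp
    qed
    from this[of z z'] this[of z' z] that show ?thesis by force
  qed
  ultimately show ?thesis by metis
qed

text \<open>For m = -M the terms of index k < M vanish, being multiples of \<open>rGamma\<close> at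
  non-positive integers. Shifting the index by M in the rest exchanges the roles of the two
  factorials and leaves the sign (-1)^M.\<close>

lemma bessel_J_eq:
  "bessel_J m x = (if m \<ge> 0 then 1 else (-1) ^ nat \<bar>m\<bar>) * bessel_nat (nat \<bar>m\<bar>) x"
proof -
  define M where "M = nat \<bar>m\<bar>"
  have rG: "rGamma (real j + 1) = 1 / fact j" for j
    using Gamma_fact[of j, where 'a=real] by (simp only: rGamma_inverse_Gamma add.commute[of "real j"] inverse_eq_divide)
  have pow: "(x / 2) powi (int M + 2 * int k) = (x / 2) ^ M * (x\<^sup>2 / 4) ^ k" for k
  proof -
    have "int M + 2 * int k = int (M + 2 * k)" by simp
    then have "(x / 2) powi (int M + 2 * int k) = (x / 2) ^ (M + 2 * k)"
      by (simp only: power_int_of_nat)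
    also have "\<dots> = (x / 2) ^ M * ((x / 2)\<^sup>2) ^ k" by (simp only: power_add power_mult)
    finally show ?thesis by (simp add: power_divide)
  qed
  have S: "(\<lambda>k. (x / 2) ^ M * ((-1) ^ k / (fact k * fact (k + M)) * (x\<^sup>2 / 4) ^ k)) sums bessel_nat M x"
    unfolding bessel_nat_def bessel_series_def
    by (intro sums_mult summable_sums summable_bessel_series)
  let ?t = "\<lambda>k. (-1) ^ k / fact k * rGamma (of_int m + of_nat k + 1) * (x / 2) powi (m + 2 * int k)"
  show ?thesis
  proof (cases "m \<ge> 0")
    case True
    then have m: "m = int M" by (simp add: M_def)
    have "?t k = (x / 2) ^ M * ((-1) ^ k / (fact k * fact (k + M)) * (x\<^sup>2 / 4) ^ k)" for k
    proof -
      have "rGamma (of_int m + of_nat k + 1 :: real) = 1 / fact (k + M)"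
        using rG[of "k + M"] by (simp add: m add_ac)
      then show ?thesis unfolding m pow by simp
    qed
    with S have "?t sums bessel_nat M x" by simp
    then show ?thesis using True by (simp add: bessel_J_def M_def sums_iff)
  next
    case False
    then have m: "m = - int M" by (simp add: M_def)
    have zero: "?t k = 0" if "k < M" for k
    proof -
      have e: "of_int m + of_nat k + 1 = (- real (M - Suc k) :: real)" using that by (simp add: m of_nat_diff)
      have "rGamma (of_int m + of_nat k + 1 :: real) = 0"
        unfolding e by (subst rGamma_eq_zero_iff) simp
      then show ?thesis by simp
    qed
    have "?t (k + M) = (-1) ^ M * ((x / 2) ^ M * ((-1) ^ k / (fact k * fact (k + M)) * (x\<^sup>2 / 4) ^ k))" for k
    proof -
      have "m + 2 * int (k + M) = int M + 2 * int k" by (simp add: m)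
      then have "(x / 2) powi (m + 2 * int (k + M)) = (x / 2) ^ M * (x\<^sup>2 / 4) ^ k"
        by (simp only: pow)
      moreover have "rGamma (of_int m + of_nat (k + M) + 1 :: real) = 1 / fact k"
        using rG[of k] by (simp add: m)
      ultimately show ?thesis by (simp only:) (simp add: power_add mult.commute[of "fact (k + M)"])
    qed
    then have "(\<lambda>k. ?t (k + M)) sums ((-1) ^ M * bessel_nat M x)"
      by (simp only:) (intro sums_mult S)
    then have "?t sums ((-1) ^ M * bessel_nat M x)"
    proof -
      have "(\<Sum>i<M. ?t i) = 0" by (intro sum.neutral ballI zero) simp
      then show "?t sums ((-1) ^ M * bessel_nat M x)" if "(\<lambda>k. ?t (k + M)) sums ((-1) ^ M * bessel_nat M x)"
        using that sums_iff_shift[of ?t M "(-1) ^ M * bessel_nat M x"] by (simp only: add_0_right)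
    qed
    then show ?thesis using False by (simp add: bessel_J_def M_def sums_iff)
  qed
qed

lemma bessel_zero_props:
  assumes "n \<ge> 1"
  shows "bessel_zero m n > 0" and "bessel_nat (nat \<bar>m\<bar>) (bessel_zero m n) = 0"
proof -
  define Z where "Z = {x. 0 < x \<and> bessel_nat (nat \<bar>m\<bar>) x = 0}"
  have J: "bessel_J m x = 0 \<longleftrightarrow> bessel_nat (nat \<bar>m\<bar>) x = 0" for x by (simp add: bessel_J_eq)
  have "\<exists>!z. z \<in> Z \<and> card {x\<in>Z. x \<le> z} = n"
  proof (rule ex1_nth_element)
    show "finite {x\<in>Z. x \<le> a}" for a
      using finite_bessel_nat_zeros[of a "nat \<bar>m\<bar>"] by (rule finite_subset[rotated]) (auto simp: Z_def)
    show "\<exists>x\<in>Z. x > a" for a using bessel_nat_zeros_unbounded[of a] by (auto simp: Z_def)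
  qed (use assms in auto)
  moreover have "(z \<in> Z \<and> card {x\<in>Z. x \<le> z} = n) \<longleftrightarrow> (0 < z \<and> bessel_J m z = 0 \<and>
                             card {x. 0 < x \<and> x \<le> z \<and> bessel_J m x = 0} = n)" for z
  proof -
    have "{x\<in>Z. x \<le> z} = {x. 0 < x \<and> x \<le> z \<and> bessel_J m x = 0}" by (auto simp: Z_def J)
    then show ?thesis by (auto simp: Z_def J)
  qed
  ultimately have "\<exists>!z. 0 < z \<and> bessel_J m z = 0 \<and> card {x. 0 < x \<and> x \<le> z \<and> bessel_J m x = 0} = n"
    by simp
  from theI'[OF this] have "0 < bessel_zero m n \<and> bessel_J m (bessel_zero m n) = 0"
    unfolding bessel_zero_def by blast
  then show "bessel_zero m n > 0" "bessel_nat (nat \<bar>m\<bar>) (bessel_zero m n) = 0"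
    unfolding J by blast+
qed

section \<open>Integrals of Bessel functions\<close>

text \<open>The Weierstrass test with majorant B C^k / k! gives uniform convergence on the interval,
  hence termwise integration.\<close>

lemma sums_integral_mult_exp:
  fixes g h :: "real \<Rightarrow> complex"
  assumes h: "continuous_on {a..b} h" and g: "continuous_on {a..b} g"
    and C: "\<And>t. t \<in> {a..b} \<Longrightarrow> norm (g t) \<le> C"
  shows "(\<lambda>k. integral {a..b} (\<lambda>t. h t * g t ^ k / fact k)) sums integral {a..b} (\<lambda>t. h t * exp (g t))"
proof -
  obtain B where "\<forall>t\<in>{a..b}. norm (h t) \<le> B"
    using compact_imp_bounded[OF compact_continuous_image[OF h compact_Icc]]
    unfolding bounded_iff by auto
  then have B: "norm (h t) \<le> B" if "t \<in> {a..b}" for t using that by blast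
  have "uniform_limit {a..b} (\<lambda>n t. \<Sum>k<n. h t * g t ^ k / fact k) (\<lambda>t. \<Sum>k. h t * g t ^ k / fact k) sequentially"
  proof (rule Weierstrass_m_test)
    show "norm (h t * g t ^ k / fact k) \<le> B * (C ^ k /\<^sub>R fact k)" if "t \<in> {a..b}" for k t
    proof -
      have "norm (h t) * norm (g t) ^ k \<le> B * C ^ k"
        using B[OF that] C[OF that] norm_ge_zero[of "h t"] norm_ge_zero[of "g t"]
        by (intro mult_mono power_mono zero_le_power) linarith+
      then have "norm (h t) * norm (g t) ^ k / fact k \<le> B * C ^ k / fact k"
        by (rule divide_right_mono) simp
      then show ?thesis by (simp add: norm_mult norm_divide norm_power field_simps)
    qed
    show "summable (\<lambda>k. B * (C ^ k /\<^sub>R fact k))"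
      by (intro summable_mult summable_exp_generic)
  qed
  moreover have "(\<Sum>k. h t * g t ^ k / fact k) = h t * exp (g t)" for t
  proof -
    have "(\<lambda>k. h t * (g t ^ k /\<^sub>R fact k)) sums (h t * exp (g t))"
      by (intro sums_mult exp_converges)
    then show ?thesis by (simp add: sums_iff scaleR_conv_of_real divide_inverse mult_ac)
  qed
  ultimately have u: "uniform_limit {a..b} (\<lambda>n t. \<Sum>k<n. h t * g t ^ k / fact k) (\<lambda>t. h t * exp (g t)) sequentially"
    by simp
  have cont: "continuous_on {a..b} (\<lambda>t. h t * g t ^ k / fact k)" for k
    by (intro continuous_intros h g) auto
  obtain I J where I: "\<And>n. ((\<lambda>t. \<Sum>k<n. h t * g t ^ k / fact k) has_integral I n) {a..b}"
      and J: "((\<lambda>t. h t * exp (g t)) has_integral J) {a..b}" and lim: "I \<longlonglongrightarrow> J"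
    by (rule uniform_limit_integral[OF u continuous_on_sum[OF cont] sequentially_bot]) blast
  have "I n = (\<Sum>k<n. integral {a..b} (\<lambda>t. h t * g t ^ k / fact k))" for n
  proof -
    have "((\<lambda>t. \<Sum>k<n. h t * g t ^ k / fact k) has_integral (\<Sum>k<n. integral {a..b} (\<lambda>t. h t * g t ^ k / fact k))) {a..b}"
      by (intro has_integral_sum finite_lessThan integrable_integral integrable_continuous_interval cont)
    with I[of n] show ?thesis by (rule has_integral_unique)
  qed
  then have "I = (\<lambda>n. \<Sum>k<n. integral {a..b} (\<lambda>t. h t * g t ^ k / fact k))" by (rule ext)
  with lim show ?thesis by (simp only: sums_def integral_unique[OF J])
qed

lemma integral_cis_int: "integral {0..2 * pi} (\<lambda>t. cis (of_int j * t)) = (if j = 0 then of_real (2 * pi) else 0)"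
proof (cases "j = 0")
  case False
  have "((\<lambda>t. cis (of_int j * t)) has_integral (- \<i> / of_int j * cis (of_int j * (2 * pi)) - (- \<i> / of_int j * cis (of_int j * 0)))) {0..2 * pi}"
  proof (rule fundamental_theorem_of_calculus)
    fix t :: real
    have "((\<lambda>w. - \<i> / of_int j * exp (\<i> * (of_int j * w))) has_field_derivative exp (\<i> * (of_int j * of_real t))) (at (of_real t))"
      using False by (auto intro!: derivative_eq_intros simp: field_simps)
    from has_vector_derivative_real_field[OF this, of "{0..2 * pi}"]
    show "((\<lambda>t. - \<i> / of_int j * cis (of_int j * t)) has_vector_derivative cis (of_int j * t)) (at t within {0..2 * pi})"
      by (simp add: cis_conv_exp)
  qed simp
  moreover have "cis (of_int j * (2 * pi)) = 1"
    using cis_multiple_2pi[of "of_int j"] by (simp add: mult_ac)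
  ultimately show ?thesis using False by (simp add: integral_unique)
qed (simp add: scaleR_conv_of_real)

text \<open>Expanding both factors of \<open>exp (\<i>\<rho>/2 e\<^sup>i\<^sup>s) exp (\<i>\<rho>/2 e\<^sup>-\<^sup>i\<^sup>s) = exp (\<i>\<rho> cos s)\<close>, only the terms with
  matching frequencies survive the integration, and they form the series of \<open>J\<^sub>m\<close>.\<close>

lemma integral_cis_cos:
  "integral {0..2 * pi} (\<lambda>t. cis (- (of_int m * t)) * cis (\<rho> * cos (t + \<alpha>)))
     = of_real (2 * pi) * \<i> powi m * of_real (bessel_J m \<rho>) * cis (of_int m * \<alpha>)"
proof -
  define c where "c = \<i> * of_real \<rho> / 2 * cis \<alpha>"
  define d where "d = \<i> * of_real \<rho> / 2 * cis (- \<alpha>)"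
  have split: "cis (\<rho> * cos (t + \<alpha>)) = exp (c * cis t) * exp (d * cis (- t))" for t
  proof -
    have "c * cis t + d * cis (- t) = \<i> * of_real \<rho> / 2 * (cis (t + \<alpha>) + cis (- (t + \<alpha>)))"
      by (simp add: c_def d_def algebra_simps cis_mult)
    also have "cis (t + \<alpha>) + cis (- (t + \<alpha>)) = of_real (2 * cos (t + \<alpha>))"
      by (simp only: cis_cnj[symmetric] complex_add_cnj cis.simps)
    finally show ?thesis by (simp add: exp_add[symmetric] cis_conv_exp)
  qed
  have norms: "norm (c * cis t) \<le> norm c" "norm (d * cis (- t)) \<le> norm d" for t
    by (simp_all add: norm_mult)
  \<comment> \<open>Here only \<open>exp (c * cis t)\<close> is expanded. Its k-th term contributes
    the frequency j + k, so only k = -j survives.\<close>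
  have inner: "integral {0..2 * pi} (\<lambda>t. cis (of_int j * t) * exp (c * cis t))
      = of_real (2 * pi) * (if j \<le> 0 then c ^ nat (- j) / fact (nat (- j)) else 0)" for j
  proof -
    have "(\<lambda>k. integral {0..2 * pi} (\<lambda>t. cis (of_int j * t) * (c * cis t) ^ k / fact k))
       sums integral {0..2 * pi} (\<lambda>t. cis (of_int j * t) * exp (c * cis t))"
      by (rule sums_integral_mult_exp[OF _ _ norms(1)]) (auto intro!: continuous_intros simp: cis_conv_exp)
    moreover have "integral {0..2 * pi} (\<lambda>t. cis (of_int j * t) * (c * cis t) ^ k / fact k)
        = (if int k = - j then of_real (2 * pi) * (c ^ k / fact k) else 0)" for k
    proof -
      have "cis (of_int j * t) * (c * cis t) ^ k / fact k = (c ^ k / fact k) * cis (of_int (j + int k) * t)" for t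
      proof -
        have "cis (of_int j * t) * cis t ^ k = cis (of_int (j + int k) * t)"
          by (simp only: Complex.DeMoivre cis_mult of_int_add of_int_of_nat_eq distrib_right)
        then show ?thesis by (simp add: power_mult_distrib mult_ac)
      qed
      then have "integral {0..2 * pi} (\<lambda>t. cis (of_int j * t) * (c * cis t) ^ k / fact k)
          = (c ^ k / fact k) * integral {0..2 * pi} (\<lambda>t. cis (of_int (j + int k) * t))"
        by (simp only: integral_mult_right)
      then show ?thesis unfolding integral_cis_int by auto
    qed
    ultimately have s: "(\<lambda>k. if int k = - j then of_real (2 * pi) * (c ^ k / fact k) else 0)
       sums integral {0..2 * pi} (\<lambda>t. cis (of_int j * t) * exp (c * cis t))" by simp
    show ?thesis
    proof (cases "j \<le> 0")
      case True
      then have "(int k = - j) = (k = nat (- j))" for k by auto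
      with s have "(\<lambda>k. if k = nat (- j) then of_real (2 * pi) * (c ^ k / fact k) else 0)
       sums integral {0..2 * pi} (\<lambda>t. cis (of_int j * t) * exp (c * cis t))" by simp
      then show ?thesis using True sums_unique2[OF _ sums_single] by fastforce
    next
      case False
      then have "int k \<noteq> - j" for k by auto
      with s have "(\<lambda>k. 0) sums integral {0..2 * pi} (\<lambda>t. cis (of_int j * t) * exp (c * cis t))" by simp
      then show ?thesis using False sums_unique2[OF _ sums_zero] by fastforce
    qed
  qed
  define T where "T k = (-1) ^ k / fact k * rGamma (of_int m + of_nat k + 1) * (\<rho> / 2) powi (m + 2 * int k)" for k
  define E where "E = of_real (2 * pi) * \<i> powi m * cis (of_int m * \<alpha>)"
  have "(\<lambda>k. integral {0..2 * pi} (\<lambda>t. cis (- (of_int m * t)) * exp (c * cis t) * (d * cis (- t)) ^ k / fact k))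
       sums integral {0..2 * pi} (\<lambda>t. cis (- (of_int m * t)) * exp (c * cis t) * exp (d * cis (- t)))"
    by (rule sums_integral_mult_exp[OF _ _ norms(2)]) (auto intro!: continuous_intros simp: cis_conv_exp)
  moreover have "integral {0..2 * pi} (\<lambda>t. cis (- (of_int m * t)) * exp (c * cis t) * (d * cis (- t)) ^ k / fact k)
      = E * of_real (T k)" for k
  proof -
    have "cis (- (of_int m * t)) * exp (c * cis t) * (d * cis (- t)) ^ k / fact k
        = (d ^ k / fact k) * (cis (of_int (- m - int k) * t) * exp (c * cis t))" for t
    proof -
      have "cis (- (of_int m * t)) * cis (- t) ^ k = cis (of_int (- m - int k) * t)"
        by (simp add: Complex.DeMoivre cis_mult algebra_simps)
      then show ?thesis by (simp add: power_mult_distrib mult_ac)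
    qed
    then have "integral {0..2 * pi} (\<lambda>t. cis (- (of_int m * t)) * exp (c * cis t) * (d * cis (- t)) ^ k / fact k)
       = (d ^ k / fact k) * integral {0..2 * pi} (\<lambda>t. cis (of_int (- m - int k) * t) * exp (c * cis t))"
      by (simp only: integral_mult_right)
    also have "\<dots> = E * of_real (T k)"
    proof (cases "m + int k \<ge> 0")
      case True
      \<comment> \<open>The index at which the expansion of \<open>exp (c * cis t)\<close> meets the
        k-th term of the other factor.\<close>
      define l where "l = nat (m + int k)"
      have m: "m = int l - int k" using True by (simp add: l_def)
      have "rGamma (real l + 1) = 1 / fact l"
        using Gamma_fact[of l, where 'a=real] by (simp only: rGamma_inverse_Gamma add.commute[of "real l"] inverse_eq_divide)
      moreover have "m + 2 * int k = int (l + k)" by (simp add: m)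
      ultimately have T: "T k = (-1) ^ k / fact k * (1 / fact l) * (\<rho> / 2) ^ (l + k)"
        unfolding T_def by (simp only: power_int_of_nat) (simp add: m)
      have ii: "\<i> ^ k * \<i> ^ l = \<i> powi m * (-1) ^ k"
      proof -
        have "\<i> powi int (l + k) = \<i> powi (m + int (2 * k))" by (simp add: m add.commute)
        also have "\<dots> = \<i> powi m * \<i> powi int (2 * k)" by (rule power_int_add) simp
        also have "\<i> powi int (2 * k) = (\<i>\<^sup>2) ^ k" by (simp only: power_int_of_nat power_mult)
        finally show ?thesis by (simp only: power_int_of_nat power_add mult.commute) simp
      qed
      have cc: "cis (- \<alpha>) ^ k * cis \<alpha> ^ l = cis (of_int m * \<alpha>)"
        by (simp add: Complex.DeMoivre cis_mult m algebra_simps)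
      have "d ^ k * c ^ l = (\<i> ^ k * \<i> ^ l) * (cis (- \<alpha>) ^ k * cis \<alpha> ^ l) * (of_real \<rho> / 2) ^ (l + k)"
        by (simp add: c_def d_def power_mult_distrib power_add power_divide mult_ac)
      also have "\<dots> = \<i> powi m * (-1) ^ k * cis (of_int m * \<alpha>) * (of_real \<rho> / 2) ^ (l + k)"
        by (simp only: ii cc)
      finally have dc: "d ^ k * c ^ l = \<i> powi m * (-1) ^ k * cis (of_int m * \<alpha>) * (of_real \<rho> / 2) ^ (l + k)" .
      have "nat (- (- m - int k)) = l" "- m - int k \<le> 0" using True by (simp_all add: l_def)
      then have "(d ^ k / fact k) * integral {0..2 * pi} (\<lambda>t. cis (of_int (- m - int k) * t) * exp (c * cis t))
          = of_real (2 * pi) * (d ^ k * c ^ l) / (fact k * fact l)"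
        unfolding inner by simp
      then show ?thesis unfolding dc T E_def by simp
    next
      case False
      \<comment> \<open>For k < -m the inner integral is zero, and so is the k-th term of
        \<open>bessel_J\<close>, because \<open>rGamma\<close> has a zero there.\<close>
      then have e: "of_int m + of_nat k + 1 = (- real (nat (- m - int k - 1)) :: real)" by simp
      have "rGamma (of_int m + of_nat k + 1 :: real) = 0"
        unfolding e by (subst rGamma_eq_zero_iff) simp
      then show ?thesis using False unfolding inner T_def by simp
    qed
    finally show ?thesis .
  qed
  ultimately have S: "(\<lambda>k. E * of_real (T k)) sums
      integral {0..2 * pi} (\<lambda>t. cis (- (of_int m * t)) * exp (c * cis t) * exp (d * cis (- t)))" (is "_ sums ?I")
    by simp
  \<comment> \<open>Division by the nonzero \<open>E\<close> turns the convergence just shown into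
    summability of the defining series of \<open>bessel_J\<close>.\<close>
  have E: "E \<noteq> 0" by (simp add: E_def)
  from sums_mult[OF S, of "inverse E"] E have "(\<lambda>k. of_real (T k)) sums (inverse E * ?I)"
    by (simp add: mult.assoc[symmetric])
  then have "summable T" by (simp add: sums_iff summable_of_real_iff)
  then have "T sums bessel_J m \<rho>" by (simp add: bessel_J_def T_def[abs_def] summable_sums)
  then have "(\<lambda>k. E * of_real (T k)) sums (E * of_real (bessel_J m \<rho>))"
    by (intro sums_mult) (simp only: sums_of_real_iff)
  with S have "?I = E * of_real (bessel_J m \<rho>)" by (rule sums_unique2)
  then show ?thesis by (simp add: split E_def mult_ac)
qed

section \<open>Lommel's integrals of products of Bessel functions\<close>

lemma bessel_nat_Suc_at_0 [simp]: "bessel_nat (Suc M) 0 = 0"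
  by (simp add: bessel_nat_def)

text \<open>The quotient is taken over r and not over c r, so that c = 0 is covered; this value
  arises from the frequency k = 0.\<close>

lemma DERIV_bessel_nat_scaled:
  assumes "r > 0"
  shows "((\<lambda>r. bessel_nat M (c * r)) has_real_derivative
           (real M * bessel_nat M (c * r) - c * r * bessel_nat (Suc M) (c * r)) / r) (at r)"
proof (cases "c = 0")
  case True
  then show ?thesis by (cases M) simp_all
next
  case False
  with assms have "c * r \<noteq> 0" by simp
  have "((\<lambda>r. c * r) has_real_derivative c) (at r)" by (auto intro!: derivative_eq_intros)
  from DERIV_chain2[OF DERIV_bessel_nat[OF \<open>c * r \<noteq> 0\<close>, of M] this] show ?thesis
    by (rule DERIV_cong) (use False assms in \<open>simp add: field_simps\<close>)
qed

lemma DERIV_bessel_nat_Suc_scaled: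
  assumes "r > 0"
  shows "((\<lambda>r. bessel_nat (Suc M) (c * r)) has_real_derivative
           (c * r * bessel_nat M (c * r) - real (Suc M) * bessel_nat (Suc M) (c * r)) / r) (at r)"
proof (cases "c = 0")
  case False
  with assms have "c * r \<noteq> 0" by simp
  have "((\<lambda>r. c * r) has_real_derivative c) (at r)" by (auto intro!: derivative_eq_intros)
  from DERIV_chain2[OF DERIV_bessel_nat_Suc[OF \<open>c * r \<noteq> 0\<close>, of M] this] show ?thesis
    by (rule DERIV_cong) (use False assms in \<open>simp add: field_simps\<close>)
qed simp

text \<open>\<open>F\<close> is r times the Wronskian of J_M(z r) and J_M(\<rho> r). These solve the
  radial Bessel equation with parameters z^2 and \<rho>^2, so the derivative of \<open>F\<close> is
  the difference of the parameters times r times the product. At r = 1 one of the two terms drops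
  out because J_M(z) = 0.\<close>

lemma lommel_integral:
  assumes z: "z > 0" "bessel_nat M z = 0"
  shows "((\<lambda>r. (\<rho>\<^sup>2 - z\<^sup>2) * (r * (bessel_nat M (z * r) * bessel_nat M (\<rho> * r)))) has_integral
           - (z * bessel_nat (Suc M) z * bessel_nat M \<rho>)) {0..1}"
proof -
  define F where "F r = r * (\<rho> * (bessel_nat M (z * r) * bessel_nat (Suc M) (\<rho> * r))
     - z * (bessel_nat (Suc M) (z * r) * bessel_nat M (\<rho> * r)))" for r
  have "((\<lambda>r. (\<rho>\<^sup>2 - z\<^sup>2) * (r * (bessel_nat M (z * r) * bessel_nat M (\<rho> * r)))) has_integral (F 1 - F 0)) {0..1}"
  \<comment> \<open>The derivative rules divide by r; at the end point 0 continuity of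
    \<open>F\<close> is enough.\<close>
  proof (rule fundamental_theorem_of_calculus_interior)
    show "continuous_on {0..1} F" unfolding F_def by (intro continuous_intros)
    fix r :: real assume "r \<in> {0<..<1}"
    then have r: "r > 0" by simp
    have "(F has_real_derivative (\<rho>\<^sup>2 - z\<^sup>2) * (r * (bessel_nat M (z * r) * bessel_nat M (\<rho> * r)))) (at r)"
      unfolding F_def
      apply (rule DERIV_cong)
       apply (rule DERIV_ident DERIV_bessel_nat_Suc_scaled[OF r] DERIV_bessel_nat_scaled[OF r] DERIV_cmult DERIV_diff DERIV_mult)+
      using r by (simp add: field_simps power2_eq_square)
    then show "(F has_vector_derivative (\<rho>\<^sup>2 - z\<^sup>2) * (r * (bessel_nat M (z * r) * bessel_nat M (\<rho> * r)))) (at r)"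
      by (simp only: has_real_derivative_iff_has_vector_derivative)
  qed simp
  then show ?thesis using z by (simp add: F_def mult.assoc)
qed

text \<open>The case \<rho> = z, where \<open>lommel_integral\<close> degenerates to 0 = 0. The
  primitive is r^2 (J_M^2 - J_(M-1) J_(M+1)) at z r, with J_(M-1) eliminated by the recurrence so
  that M = 0 is covered too.\<close>

lemma lommel_integral_diagonal:
  assumes z: "z > 0" "bessel_nat M z = 0"
  shows "((\<lambda>r. r * (bessel_nat M (z * r) * bessel_nat M (z * r))) has_integral (bessel_nat (Suc M) z)\<^sup>2 / 2) {0..1}"
proof -
  define F where "F r = r * r * (bessel_nat M (z * r) * bessel_nat M (z * r) + bessel_nat (Suc M) (z * r) * bessel_nat (Suc M) (z * r))
     - 2 * real M / z * (r * (bessel_nat M (z * r) * bessel_nat (Suc M) (z * r)))" for r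
  have "((\<lambda>r. 2 * (r * (bessel_nat M (z * r) * bessel_nat M (z * r)))) has_integral (F 1 - F 0)) {0..1}"
  proof (rule fundamental_theorem_of_calculus_interior)
    show "continuous_on {0..1} F" unfolding F_def by (intro continuous_intros)
    fix r :: real assume "r \<in> {0<..<1}"
    then have r: "r > 0" by simp
    have "(F has_real_derivative 2 * (r * (bessel_nat M (z * r) * bessel_nat M (z * r)))) (at r)"
      unfolding F_def
      apply (rule DERIV_cong)
       apply (rule DERIV_ident DERIV_bessel_nat_Suc_scaled[OF r] DERIV_bessel_nat_scaled[OF r] DERIV_cmult DERIV_add DERIV_diff DERIV_mult)+
      using r z(1) by (simp add: field_simps power2_eq_square)
    then show "(F has_vector_derivative 2 * (r * (bessel_nat M (z * r) * bessel_nat M (z * r)))) (at r)"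
      by (simp only: has_real_derivative_iff_has_vector_derivative)
  qed simp
  from has_integral_mult_right[OF this, of "1/2"] show ?thesis
    using z by (simp add: F_def power2_eq_square)
qed

text \<open>In effect the positive zeros of J_M are simple. Otherwise the integral of r J_M(z r)^2
  over [0,1] would be 0, so J_M would vanish on all of (0,z] and have infinitely many zeros
  there.\<close>

lemma bessel_nat_Suc_nonzero_at_zero:
  assumes z: "z > 0" "bessel_nat M z = 0"
  shows "bessel_nat (Suc M) z \<noteq> 0"
proof
  assume q: "bessel_nat (Suc M) z = 0"
  have *: "r * (bessel_nat M (z * r) * bessel_nat M (z * r)) = 0" if "r \<in> {0..1}" for r
  proof (rule has_integral_0_cbox_imp_0[where a=0 and b="1::real" and f="\<lambda>r. r * (bessel_nat M (z * r) * bessel_nat M (z * r))"])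
    show "continuous_on (cbox 0 1) (\<lambda>r. r * (bessel_nat M (z * r) * bessel_nat M (z * r)))"
      by (intro continuous_intros)
    show "((\<lambda>r. r * (bessel_nat M (z * r) * bessel_nat M (z * r))) has_integral 0) (cbox 0 1)"
      using lommel_integral_diagonal[OF z] q by simp
  qed (use that in auto)
  have "bessel_nat M x = 0" if "0 < x" "x \<le> z" for x
    using that z(1) *[of "x / z"] by simp
  then have "{0<..z} \<subseteq> {x. 0 < x \<and> x \<le> z \<and> bessel_nat M x = 0}" by auto
  then have "finite {0<..z}" using finite_bessel_nat_zeros finite_subset by blast
  then show False using z(1) by (simp add: infinite_Ioc)
qed

definition bessel_slope :: "int \<Rightarrow> nat \<Rightarrow> real" where
  "bessel_slope m n = deriv (bessel_J m) (bessel_zero m n)"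

lemma bessel_slope_eq:
  assumes "n \<ge> 1"
  shows "bessel_slope m n = - (if m \<ge> 0 then 1 else (-1) ^ nat \<bar>m\<bar>) * bessel_nat (Suc (nat \<bar>m\<bar>)) (bessel_zero m n)"
proof -
  note z = bessel_zero_props[OF assms, of m]
  have "(bessel_J m has_real_derivative (if m \<ge> 0 then 1 else (-1) ^ nat \<bar>m\<bar>) *
     (real (nat \<bar>m\<bar>) / bessel_zero m n * bessel_nat (nat \<bar>m\<bar>) (bessel_zero m n) - bessel_nat (Suc (nat \<bar>m\<bar>)) (bessel_zero m n)))
     (at (bessel_zero m n))"
    unfolding bessel_J_eq[abs_def] using z(1) by (intro DERIV_cmult DERIV_bessel_nat) simp
  then show ?thesis unfolding bessel_slope_def using z(2) by (simp add: DERIV_imp_deriv)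
qed

lemma bessel_slope_nonzero: "n \<ge> 1 \<Longrightarrow> bessel_slope m n \<noteq> 0"
  using bessel_nat_Suc_nonzero_at_zero[OF bessel_zero_props] by (simp add: bessel_slope_eq)

text \<open>Both branches of \<open>bessel_quotient\<close>, the limiting value included, are the
  same Lommel integral up to one factor. From here on no case distinction on \<rho> = z is
  needed.\<close>

lemma has_integral_bessel_quotient:
  assumes "n \<ge> 1" "\<rho> \<ge> 0"
  shows "((\<lambda>r. r * (bessel_J m (bessel_zero m n * r) * bessel_J m (\<rho> * r))) has_integral
           bessel_zero m n * bessel_slope m n * bessel_quotient m n \<rho>) {0..1}"
proof -
  define s where "s = (if m \<ge> 0 then 1 else (-1) ^ nat \<bar>m\<bar> :: real)"
  define M where "M = nat \<bar>m\<bar>"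
  define z where "z = bessel_zero m n"
  \<comment> \<open>The sign relating J_m to the natural order occurs twice in every product and
    cancels.\<close>
  have ss: "s * s = 1" by (simp add: s_def flip: power_add mult_2)
  have ssx: "s * (s * x) = x" for x using ss by (simp add: mult.assoc[symmetric])
  note z = bessel_zero_props[OF assms(1), of m, folded z_def M_def]
  have J: "bessel_J m x = s * bessel_nat M x" for x by (simp add: bessel_J_eq s_def M_def)
  have D: "bessel_slope m n = - s * bessel_nat (Suc M) z"
    using bessel_slope_eq[OF assms(1), of m] by (simp add: s_def M_def z_def)
  have JJ: "bessel_J m (z * r) * bessel_J m (\<rho> * r) = bessel_nat M (z * r) * bessel_nat M (\<rho> * r)" for r
    unfolding J by (simp add: mult_ac ssx)
  show ?thesis
  proof (cases "\<rho> = z")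
    case True
    have "bessel_quotient m n \<rho> = bessel_slope m n / (2 * z)"
      using True by (simp add: bessel_quotient_def Let_def z_def bessel_slope_def)
    then have "z * bessel_slope m n * bessel_quotient m n \<rho> = (bessel_nat (Suc M) z)\<^sup>2 / 2"
      using z(1) by (simp add: D power2_eq_square mult_ac ssx)
    then show ?thesis unfolding z_def[symmetric] JJ by (simp only: True lommel_integral_diagonal[OF z])
  next
    case False
    with assms z(1) have ne: "\<rho>\<^sup>2 - z\<^sup>2 \<noteq> 0" by (auto simp: power2_eq_iff)
    have "bessel_quotient m n \<rho> = s * bessel_nat M \<rho> / (\<rho>\<^sup>2 - z\<^sup>2)"
      using False by (simp add: bessel_quotient_def Let_def z_def J)
    then have "z * bessel_slope m n * bessel_quotient m n \<rho> = 1 / (\<rho>\<^sup>2 - z\<^sup>2) * - (z * bessel_nat (Suc M) z * bessel_nat M \<rho>)"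
      by (simp add: D mult_ac ssx)
    then show ?thesis unfolding z_def[symmetric] JJ
      using has_integral_mult_right[OF lommel_integral[OF z, of \<rho>], of "1 / (\<rho>\<^sup>2 - z\<^sup>2)"] ne by simp
  qed
qed

section \<open>Fourier coefficients of the Bessel modes\<close>

definition wave :: "int \<times> int \<Rightarrow> real \<times> real \<Rightarrow> complex" where
  "wave k p = cis (pi * (of_int (fst k) * fst p + of_int (snd k) * snd p))"

lemma norm_wave [simp]: "cmod (wave k p) = 1" by (simp add: wave_def)

lemma continuous_on_wave [continuous_intros]:
  "continuous_on A f \<Longrightarrow> continuous_on A (\<lambda>x. wave k (f x))"
  unfolding wave_def cis_conv_exp by (intro continuous_intros)

lemma borel_measurable_wave [measurable]: "wave k \<in> borel_measurable borel"
  by (intro borel_measurable_continuous_onI continuous_intros)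

lemma norm_Complex [simp]: "cmod (Complex (fst p) (snd p)) = norm p"
  by (simp add: complex_norm norm_prod_def)

lemma polar_norm_polar_angle: "polar (norm p) (polar_angle p) = p"
proof -
  have "rcis (norm p) (polar_angle p) = Complex (fst p) (snd p)"
    using rcis_cmod_Arg[of "Complex (fst p) (snd p)"] by (simp add: polar_angle_def)
  then have "Re (rcis (norm p) (polar_angle p)) = fst p" "Im (rcis (norm p) (polar_angle p)) = snd p"
    by simp_all
  then show ?thesis by (simp add: polar_def prod_eq_iff)
qed

lemma rotation_polar: "rotation t (polar r \<theta>) = polar r (\<theta> + t)"
  by (simp add: rotation_def polar_def cos_add sin_add algebra_simps)

lemma rotate_fun_eq: "rotate_fun \<phi> f p = f (rotation \<phi> p)"
  by (simp add: rotate_fun_def rotation_polar[symmetric] polar_norm_polar_angle)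

lemma cis_polar_angle: "p \<noteq> 0 \<Longrightarrow> cis (polar_angle p) = sgn (Complex (fst p) (snd p))"
  unfolding polar_angle_def by (subst cis_Arg) (auto simp: complex_eq_iff prod_eq_iff)

text \<open>The angle itself may jump by 2 pi under a rotation; \<open>cis\<close> of an integer
  multiple of it does not notice.\<close>

lemma cis_int_polar_angle_rotation:
  assumes "p \<noteq> 0"
  shows "cis (of_int j * polar_angle (rotation t p)) = cis (of_int j * t) * cis (of_int j * polar_angle p)"
proof -
  have "rotation t p \<noteq> 0" using assms norm_rotation[of t p] by (metis norm_eq_zero)
  moreover have "Complex (fst (rotation t p)) (snd (rotation t p)) = cis t * Complex (fst p) (snd p)"
    by (simp add: rotation_def complex_eq_iff algebra_simps)
  ultimately have "cis (polar_angle (rotation t p)) = cis t * cis (polar_angle p)"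
    using assms by (simp add: cis_polar_angle sgn_mult)
  then have "cis (polar_angle (rotation t p)) powi j = (cis t * cis (polar_angle p)) powi j" by simp
  then show ?thesis by (simp add: power_int_mult_distrib cis_power_int)
qed

section \<open>The Bessel modes, their rotations and their Fourier integrals\<close>

definition bessel_mode :: "real \<Rightarrow> int \<Rightarrow> real \<times> real \<Rightarrow> complex" where
  "bessel_mode z m p = indicator (ball 0 1) p *\<^sub>R (of_real (bessel_J m (z * norm p)) * cis (of_int (- m) * polar_angle p))"

lemma borel_measurable_bessel_J [measurable]: "bessel_J m \<in> borel_measurable borel"
  unfolding bessel_J_eq[abs_def] by measurable

lemma continuous_on_bessel_J [continuous_intros]:
  "continuous_on A f \<Longrightarrow> continuous_on A (\<lambda>x. bessel_J m (f x))"
  unfolding bessel_J_eq by (intro continuous_intros)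

text \<open>Away from the origin the angular factor is an integer power of \<open>sgn\<close> of the
  point, read as a complex number; this form is measurable without any look at the branch cut of
  \<open>polar_angle\<close>.\<close>

lemma borel_measurable_bessel_mode [measurable]: "bessel_mode z m \<in> borel_measurable borel"
proof -
  have [measurable]: "(\<lambda>p::real \<times> real. Complex (fst p) (snd p)) \<in> borel_measurable borel"
    by (intro borel_measurable_continuous_onI continuous_intros)
  have "cis (of_int j * polar_angle p) = (if p = 0 then 1 else 
      if j \<ge> 0 then sgn (Complex (fst p) (snd p)) ^ nat j else inverse (sgn (Complex (fst p) (snd p))) ^ nat (- j))" for j p
  proof (cases "p = 0")
    case False
    have "cis (of_int j * polar_angle p) = cis (polar_angle p) powi j" by (simp add: cis_power_int)
    then show ?thesis using False by (simp add: cis_polar_angle power_int_def)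
  qed (simp add: polar_angle_def Arg_zero[unfolded complex_eq_iff] zero_complex.code[symmetric])
  then have 1: "(\<lambda>p. cis (of_int (- m) * polar_angle p)) \<in> borel_measurable borel"
    by (simp only:) measurable
  have 2: "(\<lambda>p::real \<times> real. complex_of_real (bessel_J m (z * norm p))) \<in> borel_measurable borel"
    by measurable
  show ?thesis unfolding bessel_mode_def[abs_def]
    by (intro borel_measurable_scaleR borel_measurable_times borel_measurable_indicator 1 2) simp
qed

lemma bessel_mode_bounded: "\<exists>B>0. \<forall>p. cmod (bessel_mode z m p) \<le> B"
proof -
  have "bounded ((\<lambda>r. bessel_J m (z * r)) ` {0..1})"
    by (intro compact_imp_bounded compact_continuous_image continuous_intros) auto
  then obtain B where B: "B > 0" "\<And>r. r \<in> {0..1} \<Longrightarrow> \<bar>bessel_J m (z * r)\<bar> \<le> B"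
    unfolding bounded_pos by auto
  have "cmod (bessel_mode z m p) \<le> B" for p
    using B(1) B(2)[of "norm p"] by (auto simp: bessel_mode_def norm_mult indicator_def)
  with B(1) show ?thesis by blast
qed

lemma integrable_bessel_mode_mult:
  assumes [measurable]: "g \<in> borel_measurable borel" and C: "\<And>p. p \<in> ball 0 1 \<Longrightarrow> cmod (g p) \<le> C"
  shows "integrable lborel (\<lambda>p. bessel_mode z m p * g p)"
proof -
  obtain B where B: "B > 0" "\<And>p. cmod (bessel_mode z m p) \<le> B" using bessel_mode_bounded by blast
  show ?thesis
  proof (rule integrableI_bounded_set[where A="ball 0 1" and B="B * C"])
    show "AE p in lborel. p \<in> ball 0 1 \<longrightarrow> cmod (bessel_mode z m p * g p) \<le> B * C"
      using B C by (auto simp: norm_mult intro!: mult_mono less_imp_le[OF B(1)])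
    show "AE p in lborel. p \<notin> ball 0 1 \<longrightarrow> bessel_mode z m p * g p = 0"
      by (auto simp: bessel_mode_def)
  qed (auto simp: emeasure_ball)
qed

lemma bessel_mode_rotation: "bessel_mode z m (rotation t p) = cis (- (of_int m * t)) * bessel_mode z m p"
proof (cases "p = 0")
  case True
  then have "rotation t p = 0" by (simp add: rotation_def zero_prod_def)
  \<comment> \<open>The angle of the origin is 0 and does not rotate. The two sides agree there
    because for m \<noteq> 0 the mode vanishes at 0.\<close>
  moreover have "bessel_J m 0 = 0" if "m \<noteq> 0"
  proof -
    have "nat \<bar>m\<bar> \<noteq> 0" using that by simp
    then obtain M where "nat \<bar>m\<bar> = Suc M" using not0_implies_Suc by blast
    then show ?thesis by (simp add: bessel_J_eq)
  qed
  ultimately show ?thesis using True by (cases "m = 0") (simp_all add: bessel_mode_def)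
next
  case False
  then show ?thesis
    using cis_int_polar_angle_rotation[OF False, of "- m" t]
    by (simp add: bessel_mode_def indicator_def)
qed

text \<open>Averaging over all rotations reduces the plane integral to a radial one.\<close>

lemma integral_bessel_mode_wave:
  "(\<integral>p. bessel_mode z m p * wave k p \<partial>lborel)
     = \<i> powi m * cis (- (of_int m * polar_angle (real_pair k))) *
       of_real (2 * pi * integral {0..1} (\<lambda>r. r * (bessel_J m (z * r) * bessel_J m (pi * norm (real_pair k) * r))))"
    (is "?I = _")
proof -
  define \<rho> where "\<rho> = pi * norm (real_pair k)"
  define \<Phi> where "\<Phi> = polar_angle (real_pair k)"
  obtain B where B: "B > 0" "\<And>p. cmod (bessel_mode z m p) \<le> B" using bessel_mode_bounded by blast
  \<comment> \<open>For each t in the interval the integral of \<open>G\<close> over p is the wanted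
    one, by rotation invariance; for each p the integral over t is the one of
    \<open>integral_cis_cos\<close>. Fubini's theorem equates the two.\<close>
  define G where "G t p = indicator {0..2 * pi} t *\<^sub>R (cis (- (of_int m * t)) * bessel_mode z m p * wave k (rotation t p))" for t p
  have wave_rot: "wave k (rotation t p) = cis (\<rho> * norm p * cos (t + (polar_angle p - \<Phi>)))" for t p
  proof -
    have "rotation t p = polar (norm p) (polar_angle p + t)"
      using rotation_polar[of t "norm p" "polar_angle p"] by (simp add: polar_norm_polar_angle)
    moreover have "real_pair k = polar (norm (real_pair k)) \<Phi>" by (simp add: \<Phi>_def polar_norm_polar_angle)
    moreover have "pi * (fst (polar a \<Phi>) * fst (polar b s) + snd (polar a \<Phi>) * snd (polar b s)) = pi * a * b * cos (s - \<Phi>)" for a b s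
      by (simp add: polar_def cos_diff algebra_simps)
    ultimately have "pi * (fst (real_pair k) * fst (rotation t p) + snd (real_pair k) * snd (rotation t p)) = \<rho> * norm p * cos (polar_angle p + t - \<Phi>)"
      unfolding \<rho>_def by metis
    then show ?thesis by (simp add: wave_def real_pair_def algebra_simps)
  qed
  have "continuous_on UNIV (\<lambda>x::real \<times> real \<times> real. rotation (fst x) (snd x))"
    unfolding rotation_def by (intro continuous_intros)
  then have meas: "(\<lambda>x. wave k (rotation (fst x) (snd x))) \<in> borel_measurable borel" 
    by (intro borel_measurable_continuous_onI continuous_on_wave)
  have "continuous_on UNIV (\<lambda>x::real \<times> real \<times> real. cis (- (of_int m * fst x)))"
    unfolding cis_conv_exp by (intro continuous_intros)
  then have meas1: "(\<lambda>x. cis (- (of_int m * fst x))) \<in> borel_measurable (borel :: (real \<times> real \<times> real) measure)"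
    by (rule borel_measurable_continuous_onI)
  have meas2[measurable]: "(\<lambda>x. bessel_mode z m (snd x)) \<in> borel_measurable (borel :: (real \<times> real \<times> real) measure)"
    by (intro measurable_compose[OF _ borel_measurable_bessel_mode] borel_measurable_continuous_onI continuous_intros)
  have meas3[measurable]: "(\<lambda>x. indicator {0..2 * pi} (fst x) :: real) \<in> borel_measurable (borel :: (real \<times> real \<times> real) measure)"
  proof -
    have "fst \<in> (borel :: (real \<times> real \<times> real) measure) \<rightarrow>\<^sub>M borel"
      by (intro borel_measurable_continuous_onI continuous_intros)
    from measurable_compose[OF this, of "indicator {0..2 * pi}" "borel :: real measure"] show ?thesis by simp
  qed
  have "integrable (lborel \<Otimes>\<^sub>M lborel) (case_prod G)"
    unfolding lborel_prod
  proof (rule integrableI_bounded_set[where A="{0..2 * pi} \<times> cball 0 1" and B=B])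
    show "{0..2 * pi} \<times> cball 0 1 \<in> sets (lborel :: (real \<times> real \<times> real) measure)"
      by (simp add: borel_closed closed_Times)
    show "case_prod G \<in> borel_measurable (lborel :: (real \<times> real \<times> real) measure)"
    proof -
      have "case_prod G \<in> borel_measurable borel"
        unfolding G_def case_prod_beta'
        by (intro borel_measurable_scaleR borel_measurable_times meas meas1 meas2 meas3)
      then show ?thesis by simp
    qed
    show "emeasure lborel ({0..2 * pi} \<times> cball (0::real \<times> real) 1) < \<infinity>"
      by (intro emeasure_bounded_finite bounded_Times) auto
    show "AE x in lborel. x \<in> {0..2 * pi} \<times> cball 0 1 \<longrightarrow> cmod (case_prod G x) \<le> B"
      using B by (auto simp: G_def norm_mult)
    show "AE x in lborel. x \<notin> {0..2 * pi} \<times> cball 0 1 \<longrightarrow> case_prod G x = 0"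
      by (auto simp: G_def bessel_mode_def indicator_def)
  qed
  then have "(\<integral>p. (\<integral>t. G t p \<partial>lborel) \<partial>lborel) = (\<integral>t. (\<integral>p. G t p \<partial>lborel) \<partial>lborel)"
    by (rule lborel_pair.Fubini_integral)
  moreover have "(\<integral>p. G t p \<partial>lborel) = indicator {0..2 * pi} t *\<^sub>R ?I" for t
  proof -
    have "(\<integral>p. cis (- (of_int m * t)) * bessel_mode z m p * wave k (rotation t p) \<partial>lborel)
        = (\<integral>p. bessel_mode z m (rotation t p) * wave k (rotation t p) \<partial>lborel)"
      by (simp add: bessel_mode_rotation)
    also have "\<dots> = ?I" by (rule integral_rotation) simp
    finally show ?thesis by (simp add: G_def)
  qed
  moreover have "(\<integral>t. indicator {0..2 * pi} t *\<^sub>R ?I \<partial>lborel) = of_real (2 * pi) * ?I"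
    by (simp add: scaleR_conv_of_real)
  moreover have "(\<integral>t. G t p \<partial>lborel) = of_real (2 * pi) * \<i> powi m * cis (- (of_int m * \<Phi>)) *
       (indicator (ball 0 1) p *\<^sub>R of_real (bessel_J m (z * norm p) * bessel_J m (\<rho> * norm p)))" for p
  proof -
    have "(\<integral>t. G t p \<partial>lborel) = bessel_mode z m p * (LINT t:{0..2 * pi}|lborel. cis (- (of_int m * t)) * wave k (rotation t p))"
      unfolding set_lebesgue_integral_def
      by (subst integral_mult_right_zero[symmetric]) (auto simp: G_def mult_ac intro!: Bochner_Integration.integral_cong)
    also have "(LINT t:{0..2 * pi}|lborel. cis (- (of_int m * t)) * wave k (rotation t p))
        = integral {0..2 * pi} (\<lambda>t. cis (- (of_int m * t)) * cis (\<rho> * norm p * cos (t + (polar_angle p - \<Phi>))))"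
      unfolding wave_rot
      by (intro set_borel_integral_eq_integral borel_integrable_atLeastAtMost')
         (auto intro!: continuous_intros simp: cis_conv_exp)
    also have "\<dots> = of_real (2 * pi) * \<i> powi m * of_real (bessel_J m (\<rho> * norm p)) * cis (of_int m * (polar_angle p - \<Phi>))"
      by (rule integral_cis_cos)
    also have "bessel_mode z m p * \<dots> = of_real (2 * pi) * \<i> powi m *
        (indicator (ball 0 1) p *\<^sub>R of_real (bessel_J m (z * norm p) * bessel_J m (\<rho> * norm p))) *
        (cis (of_int (- m) * polar_angle p) * cis (of_int m * (polar_angle p - \<Phi>)))"
      by (simp add: bessel_mode_def mult_ac)
    also have "cis (of_int (- m) * polar_angle p) * cis (of_int m * (polar_angle p - \<Phi>)) = cis (- (of_int m * \<Phi>))"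
      by (simp add: cis_mult algebra_simps)
    finally show ?thesis by (simp add: mult_ac)
  qed
  moreover have "(\<integral>p. indicator (ball (0::real \<times> real) 1) p *\<^sub>R of_real (bessel_J m (z * norm p) * bessel_J m (\<rho> * norm p)) \<partial>lborel)
      = (complex_of_real (2 * pi * integral {0..1} (\<lambda>r. r * (bessel_J m (z * r) * bessel_J m (\<rho> * r)))))"
  proof -
    have "(\<integral>p. indicator (ball (0::real \<times> real) 1) p *\<^sub>R complex_of_real (bessel_J m (z * norm p) * bessel_J m (\<rho> * norm p)) \<partial>lborel)
       = (\<integral>r. indicator {0..1} r *\<^sub>R (of_real (2 * pi * r) * complex_of_real (bessel_J m (z * r) * bessel_J m (\<rho> * r))) \<partial>lborel)"
      by (rule integral_radial) simp
    also have "\<dots> = (\<integral>r. complex_of_real (indicator {0..1} r *\<^sub>R (2 * pi * (r * (bessel_J m (z * r) * bessel_J m (\<rho> * r))))) \<partial>lborel)"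
      by (intro Bochner_Integration.integral_cong) (auto simp: scaleR_conv_of_real)
    also have "\<dots> = of_real (LINT r:{0..1}|lborel. 2 * pi * (r * (bessel_J m (z * r) * bessel_J m (\<rho> * r))))"
      by (simp only: integral_complex_of_real set_lebesgue_integral_def)
    also have "(LINT r:{0..1}|lborel. 2 * pi * (r * (bessel_J m (z * r) * bessel_J m (\<rho> * r))))
       = integral {0..1} (\<lambda>r. 2 * pi * (r * (bessel_J m (z * r) * bessel_J m (\<rho> * r))))"
      by (intro set_borel_integral_eq_integral borel_integrable_atLeastAtMost' continuous_intros)
    finally show ?thesis by simp
  qed
  ultimately have "of_real (2 * pi) * ?I = of_real (2 * pi) * (\<i> powi m * cis (- (of_int m * \<Phi>)) *
      (complex_of_real (2 * pi * integral {0..1} (\<lambda>r. r * (bessel_J m (z * r) * bessel_J m (\<rho> * r))))))"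
    by (simp only: integral_mult_right_zero mult.assoc)
  then show ?thesis unfolding mult_cancel_left \<rho>_def \<Phi>_def by simp
qed

text \<open>The radial integral is z S Q, where S is the slope of J_m at z and Q the quotient in
  \<open>coeff_c\<close>. All of the dependence on k sits in Q and in the phase, so dividing by S,
  nonzero as the zero is simple, leaves a factor independent of k.\<close>

lemma coeff_c_eq_integral:
  assumes "n \<ge> 1"
  obtains \<kappa> where "\<And>k. coeff_c k m n = \<kappa> * (\<integral>p. bessel_mode (bessel_zero m n) m p * wave k p \<partial>lborel)"
proof
  fix k
  define z where "z = bessel_zero m n"
  define S where "S = bessel_slope m n"
  define Q where "Q = bessel_quotient m n (pi * norm (real_pair k))"
  have S: "S \<noteq> 0" using bessel_slope_nonzero[OF assms] by (simp add: S_def)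
  have "integral {0..1} (\<lambda>r. r * (bessel_J m (z * r) * bessel_J m (pi * norm (real_pair k) * r))) = z * S * Q"
    unfolding z_def S_def Q_def using has_integral_bessel_quotient[OF assms, of "pi * norm (real_pair k)" m]
    by (simp add: integral_unique)
  moreover have "exp (- \<i> * of_int m * of_real (polar_angle (real_pair k))) = cis (- (of_int m * polar_angle (real_pair k)))"
    by (simp add: cis_conv_exp mult.assoc)
  ultimately show "coeff_c k m n = epsilon_sign m * of_real (sqrt pi) * (-1) ^ n / of_real (4 * pi * bessel_slope m n) *
      (\<integral>p. bessel_mode (bessel_zero m n) m p * wave k p \<partial>lborel)"
    unfolding coeff_c_def integral_bessel_mode_wave z_def[symmetric] S_def[symmetric] Q_def[symmetric]
    using S by (simp add: field_simps)
qed

section \<open>Trigonometric polynomials on the grid\<close>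

lemma cnj_wave: "cnj (wave k p) = wave (- k) p"
  by (simp add: wave_def cis_cnj algebra_simps)

lemma wave_mult: "wave k p * wave l p = wave (k + l) p"
  by (simp add: wave_def cis_mult algebra_simps)

lemma wave_0 [simp]: "wave 0 p = 1"
  by (simp add: wave_def)

text \<open>A geometric sum over an L-th root of unity, which differs from 1 since 0 < \<bar>a\<bar>
  < L excludes aliasing. The offset -1 of the grid contributes only a constant phase.\<close>

lemma sum_cis_grid:
  assumes "\<bar>a\<bar> < int L"
  shows "(\<Sum>i=1..L. cis (pi * of_int a * grid L i)) = (if a = 0 then of_nat L else 0)"
proof (cases "a = 0")
  case False
  define w where "w = cis (2 * pi * of_int a / real L)"
  have L: "L > 0" using assms by (cases L) auto
  have "w \<noteq> 1"
  proof
    assume "w = 1"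
    then obtain n :: int where "2 * pi * of_int a / real L = of_int (2 * n) * pi"
      unfolding w_def cis_conv_exp exp_eq_1 by auto
    then have "real_of_int a = of_int n * real L" using L by (simp add: field_simps)
    then have "a = n * int L" by (metis of_int_eq_iff of_int_mult of_int_of_nat_eq)
    then have "int L dvd a" by simp
    then show False using False assms using dvd_imp_le_int[of a "int L"] by simp
  qed
  have "w ^ L = cis (2 * pi * of_int a)" unfolding w_def Complex.DeMoivre using L by simp
  then have wL: "w ^ L = 1" by (simp add: cis_multiple_2pi)
  have "(\<Sum>i=1..L. cis (pi * of_int a * grid L i)) = (\<Sum>i<L. cis (pi * of_int a * grid L (Suc i)))"
    by (simp only: One_nat_def sum.atLeast1_atMost_eq)
  also have "\<dots> = (\<Sum>i<L. cis (- (pi * of_int a)) * w ^ i)"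
  proof (rule sum.cong)
    fix i
    have "pi * of_int a * grid L (Suc i) = - (pi * of_int a) + real i * (2 * pi * of_int a / real L)"
      by (simp add: grid_def algebra_simps)
    then show "cis (pi * of_int a * grid L (Suc i)) = cis (- (pi * of_int a)) * w ^ i"
      by (simp only: w_def Complex.DeMoivre cis_mult)
  qed simp
  also have "\<dots> = cis (- (pi * of_int a)) * (\<Sum>i<L. w ^ i)" by (simp add: sum_distrib_left)
  also have "(\<Sum>i<L. w ^ i) = 0" using \<open>w \<noteq> 1\<close> wL by (simp add: geometric_sum)
  finally show ?thesis using False by simp
qed simp

abbreviation grid_points :: "nat \<Rightarrow> (real \<times> real) set" where
  "grid_points L \<equiv> grid L ` {1..L} \<times> grid L ` {1..L}"

lemma inj_on_grid: "inj_on (grid L) {1..L}"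
  by (auto simp: inj_on_def grid_def)

lemma sum_grid_points: "(\<Sum>p\<in>grid_points L. g p) = (\<Sum>i=1..L. \<Sum>j=1..L. g (grid L i, grid L j))"
  by (simp only: sum.cartesian_product' sum.reindex[OF inj_on_grid] o_def)

lemma card_grid_points: "card (grid_points L) = L\<^sup>2"
  by (simp only: card_cartesian_product card_image[OF inj_on_grid] card_atLeastAtMost power2_eq_square) simp

lemma grid_bounds: "i \<in> {1..L} \<Longrightarrow> grid L i \<in> {-1..1}"
  by (auto simp: grid_def field_simps)

lemma finite_fourier_eq: "finite_fourier f L k = of_real ((2 / real L)\<^sup>2) * (\<Sum>p\<in>grid_points L. f p * cnj (wave k p))"
proof -
  have "exp (- of_real pi * \<i> * of_real t) = cnj (cis (pi * t))" for t
    by (simp only: cis_cnj) (simp add: cis_conv_exp mult_ac)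
  then show ?thesis unfolding finite_fourier_def sum_grid_points wave_def by (simp only: fst_conv snd_conv)
qed

lemma sum_wave_grid:
  assumes "\<bar>fst k\<bar> < int L" "\<bar>snd k\<bar> < int L"
  shows "(\<Sum>p\<in>grid_points L. wave k p) = (if k = 0 then of_nat (L\<^sup>2) else 0)"
proof -
  have "wave k (x, y) = cis (pi * of_int (fst k) * x) * cis (pi * of_int (snd k) * y)" for x y
    by (simp add: wave_def cis_mult algebra_simps)
  then have "(\<Sum>p\<in>grid_points L. wave k p)
     = (\<Sum>i=1..L. cis (pi * of_int (fst k) * grid L i)) * (\<Sum>j=1..L. cis (pi * of_int (snd k) * grid L j))"
    by (simp only: sum_grid_points sum_product)
  then show ?thesis
    unfolding sum_cis_grid[OF assms(1)] sum_cis_grid[OF assms(2)]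
    by (auto simp: prod_eq_iff power2_eq_square)
qed

abbreviation freq_box :: "nat \<Rightarrow> (int \<times> int) set" where
  "freq_box K \<equiv> {k. max \<bar>fst k\<bar> \<bar>snd k\<bar> \<le> int K}"

lemma finite_freq_box: "finite (freq_box K)"
  by (rule finite_subset[of _ "{- int K..int K} \<times> {- int K..int K}"]) auto

text \<open>Differences of two frequencies have entries of size at most 2 K, just below the number 2
  K + 1 of nodes in each direction.\<close>

lemma sum_wave_grid_orthogonal:
  assumes "k \<in> freq_box K" "l \<in> freq_box K"
  shows "(\<Sum>p\<in>grid_points (2 * K + 1). wave k p * cnj (wave l p)) = (if k = l then of_nat ((2 * K + 1)\<^sup>2) else 0)"
proof -
  have "(\<Sum>p\<in>grid_points (2 * K + 1). wave (k - l) p) = (if k - l = 0 then of_nat ((2 * K + 1)\<^sup>2) else 0)"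
    by (rule sum_wave_grid) (use assms in auto)
  then show ?thesis by (simp add: cnj_wave wave_mult)
qed

text \<open>The vectors e_k have squared norm N, so N g - h is N times the difference of g and its
  orthogonal projection; expanding its squared norm, which is nonnegative, gives the claim.\<close>

lemma bessel_inequality_finite:
  fixes e :: "'k \<Rightarrow> 'x \<Rightarrow> complex"
  assumes fin: "finite X" "finite F"
    and orth: "\<And>k l. k \<in> F \<Longrightarrow> l \<in> F \<Longrightarrow> (\<Sum>x\<in>X. e k x * cnj (e l x)) = (if k = l then of_real N else 0)"
    and N: "N > 0"
  shows "(\<Sum>k\<in>F. (cmod (\<Sum>x\<in>X. g x * cnj (e k x)))\<^sup>2) \<le> N * (\<Sum>x\<in>X. (cmod (g x))\<^sup>2)"
proof -
  define a where "a k = (\<Sum>x\<in>X. g x * cnj (e k x))" for k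
  define h where "h x = (\<Sum>k\<in>F. a k * e k x)" for x
  define A where "A = (\<Sum>k\<in>F. a k * cnj (a k))"
  have gh: "(\<Sum>x\<in>X. g x * cnj (h x)) = A"
  proof -
    have "(\<Sum>x\<in>X. g x * cnj (h x)) = (\<Sum>x\<in>X. \<Sum>k\<in>F. cnj (a k) * (g x * cnj (e k x)))"
      by (simp add: h_def sum_distrib_left mult_ac)
    also have "\<dots> = (\<Sum>k\<in>F. cnj (a k) * a k)"
      by (subst sum.swap) (simp add: a_def sum_distrib_left)
    finally show ?thesis by (simp add: A_def mult.commute)
  qed
  have hh: "(\<Sum>x\<in>X. h x * cnj (h x)) = of_real N * A"
  proof -
    have "(\<Sum>x\<in>X. h x * cnj (h x)) = (\<Sum>x\<in>X. \<Sum>k\<in>F. \<Sum>l\<in>F. (a k * cnj (a l)) * (e k x * cnj (e l x)))"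
      by (simp add: h_def sum_product mult_ac)
    also have "\<dots> = (\<Sum>k\<in>F. \<Sum>l\<in>F. (a k * cnj (a l)) * (\<Sum>x\<in>X. e k x * cnj (e l x)))"
      by (subst sum.swap) (rule sum.cong[OF refl], subst sum.swap, simp add: sum_distrib_left)
    also have "\<dots> = (\<Sum>k\<in>F. a k * cnj (a k) * of_real N)"
      using fin by (intro sum.cong refl) (simp add: orth if_distrib sum.delta cong: if_cong)
    finally show ?thesis by (simp add: A_def sum_distrib_left mult_ac)
  qed
  have Ar: "A = of_real (\<Sum>k\<in>F. (cmod (a k))\<^sup>2)"
    by (simp add: A_def complex_mult_cnj cmod_power2)
  have "complex_of_real (\<Sum>x\<in>X. (cmod (of_real N * g x - h x))\<^sup>2) = (\<Sum>x\<in>X. (of_real N * g x - h x) * cnj (of_real N * g x - h x))"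
    by (simp only: of_real_sum complex_norm_square)
  also have "\<dots> = of_real (N\<^sup>2) * (\<Sum>x\<in>X. g x * cnj (g x)) - of_real N * (\<Sum>x\<in>X. g x * cnj (h x))
      - of_real N * cnj (\<Sum>x\<in>X. g x * cnj (h x)) + (\<Sum>x\<in>X. h x * cnj (h x))"
    by (simp add: algebra_simps sum.distrib sum_subtractf sum_distrib_left power2_eq_square)
  also have "\<dots> = of_real (N\<^sup>2 * (\<Sum>x\<in>X. (cmod (g x))\<^sup>2) - N * (\<Sum>k\<in>F. (cmod (a k))\<^sup>2))"
    unfolding gh hh Ar by (simp add: complex_mult_cnj cmod_power2 algebra_simps)
  finally have "(\<Sum>x\<in>X. (cmod (of_real N * g x - h x))\<^sup>2) = N * (N * (\<Sum>x\<in>X. (cmod (g x))\<^sup>2) - (\<Sum>k\<in>F. (cmod (a k))\<^sup>2))"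
    unfolding of_real_eq_iff by (simp add: power2_eq_square algebra_simps)
  moreover have "0 \<le> (\<Sum>x\<in>X. (cmod (of_real N * g x - h x))\<^sup>2)" by (intro sum_nonneg) simp
  ultimately have "0 \<le> N * (N * (\<Sum>x\<in>X. (cmod (g x))\<^sup>2) - (\<Sum>k\<in>F. (cmod (a k))\<^sup>2))" by simp
  then show ?thesis using N by (simp add: zero_le_mult_iff a_def)
qed

text \<open>The bound from the supremum on the grid to L^2, at the level of coefficients.
  \<open>finite_fourier\<close> yields 4 times the coefficients of the interpolating polynomial,
  whence 16 = 4^2.\<close>

lemma sum_finite_fourier_le:
  assumes "\<And>p. p \<in> grid_points (2 * K + 1) \<Longrightarrow> cmod (g p) \<le> \<epsilon>" "\<epsilon> \<ge> 0"
  shows "(\<Sum>k\<in>freq_box K. (cmod (finite_fourier g (2 * K + 1) k))\<^sup>2) \<le> 16 * \<epsilon>\<^sup>2"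
proof -
  define L where "L = real (2 * K + 1)"
  have L: "L > 0" by (simp add: L_def)
  have "(\<Sum>k\<in>freq_box K. (cmod (\<Sum>p\<in>grid_points (2 * K + 1). g p * cnj (wave k p)))\<^sup>2)
      \<le> L\<^sup>2 * (\<Sum>p\<in>grid_points (2 * K + 1). (cmod (g p))\<^sup>2)"
    by (rule bessel_inequality_finite)
       (use finite_freq_box sum_wave_grid_orthogonal in \<open>simp_all add: L_def\<close>)
  also have "\<dots> \<le> L\<^sup>2 * (\<Sum>p\<in>grid_points (2 * K + 1). \<epsilon>\<^sup>2)"
    using assms by (intro mult_left_mono sum_mono power_mono) auto
  also have "\<dots> = L\<^sup>2 * (L\<^sup>2 * \<epsilon>\<^sup>2)"
    by (simp only: sum_constant card_grid_points L_def of_nat_power)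
  finally have *: "(\<Sum>k\<in>freq_box K. (cmod (\<Sum>p\<in>grid_points (2 * K + 1). g p * cnj (wave k p)))\<^sup>2) \<le> L\<^sup>2 * (L\<^sup>2 * \<epsilon>\<^sup>2)" .
  have "(\<Sum>k\<in>freq_box K. (cmod (finite_fourier g (2 * K + 1) k))\<^sup>2)
      = ((2 / L)\<^sup>2)\<^sup>2 * (\<Sum>k\<in>freq_box K. (cmod (\<Sum>p\<in>grid_points (2 * K + 1). g p * cnj (wave k p)))\<^sup>2)"
    by (simp only: finite_fourier_eq norm_mult power_mult_distrib norm_of_real abs_power2 L_def sum_distrib_left[symmetric])
  also have "\<dots> \<le> ((2 / L)\<^sup>2)\<^sup>2 * (L\<^sup>2 * (L\<^sup>2 * \<epsilon>\<^sup>2))"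
    by (intro mult_left_mono *) simp
  also have "\<dots> = 16 * \<epsilon>\<^sup>2" using L by (simp add: power2_eq_square field_simps)
  finally show ?thesis .
qed

text \<open>The grid sum is exact on the products that occur. The 4 is the area of the square, in
  the form \<open>(2/L)^2 * L^2\<close>.\<close>

lemma finite_fourier_trig_poly:
  assumes "k \<in> freq_box K"
  shows "finite_fourier (\<lambda>p. \<Sum>l\<in>freq_box K. s l * wave l p) (2 * K + 1) k = 4 * s k"
proof -
  let ?L = "2 * K + 1"
  have "(\<Sum>p\<in>grid_points ?L. (\<Sum>l\<in>freq_box K. s l * wave l p) * cnj (wave k p))
      = (\<Sum>l\<in>freq_box K. s l * (\<Sum>p\<in>grid_points ?L. wave l p * cnj (wave k p)))"
    unfolding sum_distrib_right sum_distrib_left by (subst sum.swap) (simp add: mult.assoc)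
  also have "\<dots> = (\<Sum>l\<in>freq_box K. if l = k then s l * of_nat (?L\<^sup>2) else 0)"
    using sum_wave_grid_orthogonal[OF _ assms] by (intro sum.cong refl) auto
  also have "\<dots> = s k * of_nat (?L\<^sup>2)" using assms finite_freq_box by simp
  finally have 1: "(\<Sum>p\<in>grid_points ?L. (\<Sum>l\<in>freq_box K. s l * wave l p) * cnj (wave k p)) = s k * of_nat (?L\<^sup>2)" .
  have "(2 / real ?L)\<^sup>2 * real (?L\<^sup>2) = 4" by (simp add: power_divide)
  then have "complex_of_real ((2 / real ?L)\<^sup>2) * of_nat (?L\<^sup>2) = 4"
    by (metis of_real_mult of_real_numeral of_real_of_nat_eq)
  then show ?thesis unfolding finite_fourier_eq 1 by (simp only: mult.left_commute[of _ "s k"]) simp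
qed

section \<open>Parseval's identity on the square\<close>

abbreviation unit_square :: "(real \<times> real) set" where
  "unit_square \<equiv> cbox (-1, -1) (1, 1)"

lemma integral_cis_interval:
  "integral {-1..1} (\<lambda>t. cis (pi * of_int j * t)) = (if j = 0 then 2 else 0)"
proof (cases "j = 0")
  case False
  have "((\<lambda>t. cis (pi * of_int j * t)) has_integral
     (- \<i> / of_real (pi * of_int j) * cis (pi * of_int j * 1) - (- \<i> / of_real (pi * of_int j) * cis (pi * of_int j * (-1))))) {-1..1}"
  proof (rule fundamental_theorem_of_calculus)
    fix t :: real
    have "((\<lambda>w. - \<i> / of_real (pi * of_int j) * exp (\<i> * (of_real (pi * of_int j) * w))) has_field_derivative
        exp (\<i> * (of_real (pi * of_int j) * of_real t))) (at (of_real t))"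
      using False by (auto intro!: derivative_eq_intros simp: field_simps)
    from has_vector_derivative_real_field[OF this, of "{-1..1}"]
    show "((\<lambda>t. - \<i> / of_real (pi * of_int j) * cis (pi * of_int j * t)) has_vector_derivative cis (pi * of_int j * t)) (at t within {-1..1})"
      by (simp add: cis_conv_exp)
  qed simp
  moreover have "cis (pi * of_int j * 1) = cis (pi * of_int j * (-1))"
  proof -
    have "cis (pi * of_int j * 1) = cis (pi * of_int j * (-1)) * cis (2 * pi * of_int j)"
      by (simp only: cis_mult) (rule arg_cong[of _ _ cis], simp)
    then show ?thesis by (simp only: cis_multiple_2pi[OF Ints_of_int] mult_1_right)
  qed
  ultimately show ?thesis using False by (simp add: integral_unique)
qed (simp add: scaleR_conv_of_real)

lemma integral_wave: "integral unit_square (wave k) = (if k = 0 then 4 else 0)"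
proof -
  have "integral unit_square (wave k) = integral (cbox (-1) 1) (\<lambda>x. integral (cbox (-1) 1) (\<lambda>y. wave k (x, y)))"
    by (intro integral_prod_continuous continuous_intros)
  also have "\<dots> = integral {-1..1} (\<lambda>x. integral {-1..1} (\<lambda>y. cis (pi * of_int (fst k) * x) * cis (pi * of_int (snd k) * y)))"
    by (simp add: wave_def cis_mult algebra_simps)
  also have "\<dots> = (if fst k = 0 then 2 else 0) * (if snd k = 0 then 2 else 0)"
    by (simp add: integral_cis_interval)
  finally show ?thesis by (auto simp: prod_eq_iff)
qed

lemma integral_cmod_trig_poly_squared:
  assumes "finite F"
  shows "integral unit_square (\<lambda>p. (cmod (\<Sum>k\<in>F. b k * wave k p))\<^sup>2) = 4 * (\<Sum>k\<in>F. (cmod (b k))\<^sup>2)"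
proof -
  have int: "wave k integrable_on unit_square" for k
    by (intro integrable_continuous continuous_intros)
  have "complex_of_real (integral unit_square (\<lambda>p. (cmod (\<Sum>k\<in>F. b k * wave k p))\<^sup>2))
      = integral unit_square (\<lambda>p. complex_of_real ((cmod (\<Sum>k\<in>F. b k * wave k p))\<^sup>2))"
    by (intro integral_unique[symmetric] has_integral_of_real integrable_integral integrable_continuous continuous_intros)
  also have "\<dots> = integral unit_square (\<lambda>p. \<Sum>k\<in>F. \<Sum>l\<in>F. (b k * cnj (b l)) * wave (k - l) p)"
  proof (rule integral_cong)
    fix p
    have "complex_of_real ((cmod (\<Sum>k\<in>F. b k * wave k p))\<^sup>2) = (\<Sum>k\<in>F. b k * wave k p) * cnj (\<Sum>k\<in>F. b k * wave k p)"
      by (simp only: complex_norm_square)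
    also have "\<dots> = (\<Sum>k\<in>F. \<Sum>l\<in>F. (b k * cnj (b l)) * wave (k - l) p)"
      by (simp add: sum_product cnj_wave) (intro sum.cong refl, simp add: wave_mult[of _ _ "- _", simplified, symmetric] mult_ac)
    finally show "complex_of_real ((cmod (\<Sum>k\<in>F. b k * wave k p))\<^sup>2) = (\<Sum>k\<in>F. \<Sum>l\<in>F. (b k * cnj (b l)) * wave (k - l) p)" .
  qed
  also have "\<dots> = (\<Sum>k\<in>F. \<Sum>l\<in>F. (b k * cnj (b l)) * integral unit_square (wave (k - l)))"
    using assms int by (simp add: integral_sum integrable_sum integrable_on_mult_right)
  also have "\<dots> = (\<Sum>k\<in>F. \<Sum>l\<in>F. if l = k then 4 * (b k * cnj (b l)) else 0)"
    by (intro sum.cong refl) (auto simp: integral_wave)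
  also have "\<dots> = complex_of_real (4 * (\<Sum>k\<in>F. (cmod (b k))\<^sup>2))"
    using assms by (simp add: sum_distrib_left complex_mult_cnj cmod_power2)
  finally show ?thesis unfolding of_real_eq_iff .
qed

section \<open>A discrete Jackson approximation\<close>

text \<open>As N < L, orthogonality on the grid removes all off-diagonal terms, and the diagonal
  ones do not depend on the shift \<open>x\<close>. Hence the weights built below have the same sum
  at every point.\<close>

lemma sum_cmod_squared_grid:
  fixes \<beta> :: "nat \<Rightarrow> real"
  assumes "N < L"
  shows "(\<Sum>i=1..L. (cmod (\<Sum>j\<le>N. of_real (\<beta> j) * cis (pi * real j * (x - grid L i))))\<^sup>2) = real L * (\<Sum>j\<le>N. (\<beta> j)\<^sup>2)"
proof -
  have "complex_of_real (\<Sum>i=1..L. (cmod (\<Sum>j\<le>N. of_real (\<beta> j) * cis (pi * real j * (x - grid L i))))\<^sup>2)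
     = (\<Sum>i=1..L. \<Sum>j\<le>N. \<Sum>l\<le>N. of_real (\<beta> j * \<beta> l) * cis (pi * (real j - real l) * x) * cis (pi * of_int (int l - int j) * grid L i))"
    unfolding of_real_sum complex_norm_square cnj_sum sum_product
  proof (intro sum.cong refl)
    fix i j l
    have "cis (pi * real j * (x - grid L i)) * cis (- (pi * real l * (x - grid L i))) = cis (pi * (real j - real l) * x) * cis (pi * of_int (int l - int j) * grid L i)"
      unfolding cis_mult by (rule arg_cong[of _ _ cis]) (simp add: algebra_simps)
    then show "complex_of_real (\<beta> j) * cis (pi * real j * (x - grid L i)) * cnj (complex_of_real (\<beta> l) * cis (pi * real l * (x - grid L i)))
       = of_real (\<beta> j * \<beta> l) * cis (pi * (real j - real l) * x) * cis (pi * of_int (int l - int j) * grid L i)"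
      by (simp only: complex_cnj_mult complex_cnj_complex_of_real cis_cnj of_real_mult mult_ac)
  qed
  also have "\<dots> = (\<Sum>j\<le>N. \<Sum>l\<le>N. of_real (\<beta> j * \<beta> l) * cis (pi * (real j - real l) * x) * (\<Sum>i=1..L. cis (pi * of_int (int l - int j) * grid L i)))"
    by (subst sum.swap) (rule sum.cong[OF refl], subst sum.swap, simp only: sum_distrib_left)
  also have "\<dots> = (\<Sum>j\<le>N. \<Sum>l\<le>N. if l = j then of_real (real L * (\<beta> j)\<^sup>2) else 0)"
  proof (intro sum.cong refl)
    fix j l assume "j \<in> {..N}" "l \<in> {..N}"
    then have "\<bar>int l - int j\<bar> < int L" using assms by auto
    from sum_cis_grid[OF this]
    show "of_real (\<beta> j * \<beta> l) * cis (pi * (real j - real l) * x) * (\<Sum>i=1..L. cis (pi * of_int (int l - int j) * grid L i))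
       = (if l = j then of_real (real L * (\<beta> j)\<^sup>2) else 0)"
      by (simp add: power2_eq_square)
  qed
  also have "\<dots> = complex_of_real (real L * (\<Sum>j\<le>N. (\<beta> j)\<^sup>2))"
    by (simp add: sum_distrib_left)
  finally show ?thesis unfolding of_real_eq_iff .
qed

text \<open>
  For the kernel \<open>\<bar>\<Sum>j\<le>K. b\<^sub>j\<^sub>+\<^sub>1 cis (\<pi> j t)\<bar>\<^sup>2\<close>, the mean of \<open>sin\<^sup>2 (\<pi> t / 2)\<close> is a quarter of
  \<open>(\<Sum>(b\<^sub>j\<^sub>+\<^sub>1 - b\<^sub>j)\<^sup>2) / \<Sum>b\<^sub>j\<^sup>2\<close>. A parabola vanishing at \<open>0\<close> and \<open>K + 2\<close> makes this \<open>O(1/K\<^sup>2)\<close>.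
\<close>

definition kernel_coeff :: "nat \<Rightarrow> nat \<Rightarrow> real" where
  "kernel_coeff K i = real i * (real (K + 2) - real i)"

definition kernel_poly :: "nat \<Rightarrow> real \<Rightarrow> complex" where
  "kernel_poly K t = (\<Sum>j\<le>K. of_real (kernel_coeff K (Suc j)) * cis (pi * real j * t))"

definition kernel_mass :: "nat \<Rightarrow> real" where
  "kernel_mass K = (\<Sum>j\<le>K. (kernel_coeff K (Suc j))\<^sup>2)"

lemma kernel_mass_ge: "kernel_mass K \<ge> real (K + 2) ^ 5 / 60"
proof -
  define n where "n = real (K + 2)"
  \<comment> \<open>The three terms come from the sums of squares, cubes and fourth powers; the
    upper limit \<open>N\<close> is kept apart from \<open>n\<close> for the induction. At N = n the
    right-hand side is n^5 - n.\<close>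
  have closed: "30 * (\<Sum>i\<le>N. (real i * (n - real i))\<^sup>2) =
    5 * n\<^sup>2 * real N * (real N + 1) * (2 * real N + 1) - 15 * n * (real N)\<^sup>2 * (real N + 1)\<^sup>2
      + real N * (real N + 1) * (2 * real N + 1) * (3 * (real N)\<^sup>2 + 3 * real N - 1)" for N
    by (induction N) (simp_all add: power2_eq_square algebra_simps)
  have "(\<Sum>i\<le>K + 2. (kernel_coeff K i)\<^sup>2) = kernel_mass K"
  proof -
    have "K + 2 = Suc (Suc K)" "kernel_coeff K 0 = 0" "kernel_coeff K (Suc (Suc K)) = 0"
      by (simp_all add: kernel_coeff_def)
    then show ?thesis unfolding kernel_mass_def
      by (simp only: sum.atMost_Suc_shift[of _ "Suc K"] sum.atMost_Suc[of _ K]) simp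
  qed
  then have "30 * kernel_mass K = n ^ 5 - n"
    using closed[of "K + 2"] unfolding kernel_coeff_def n_def[symmetric]
    by (simp add: power2_eq_square eval_nat_numeral algebra_simps)
  moreover have "n ^ 5 / 2 \<ge> n"
  proof -
    have "n \<ge> 2" by (simp add: n_def)
    then have "n ^ 4 \<ge> 2 ^ 4" by (intro power_mono) auto
    then have "n * n ^ 4 \<ge> n * 2" using \<open>n \<ge> 2\<close> by (intro mult_left_mono) auto
    then show ?thesis by (simp add: eval_nat_numeral)
  qed
  ultimately show ?thesis unfolding n_def[symmetric] by simp
qed

lemma kernel_mass_pos: "kernel_mass K > 0"
  using kernel_mass_ge[of K] by (rule less_le_trans[rotated]) simp

text \<open>Summation by parts. There are no boundary terms because the coefficients vanish at 0 and
  at K + 2.\<close>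

lemma kernel_poly_diff:
  "(1 - cis (pi * t)) * kernel_poly K t
     = (\<Sum>j\<le>Suc K. of_real (kernel_coeff K (Suc j) - kernel_coeff K j) * cis (pi * real j * t))"
proof -
  have "(\<Sum>j\<le>Suc K. of_real (kernel_coeff K (Suc j)) * cis (pi * real j * t)) = kernel_poly K t"
    by (simp add: kernel_poly_def kernel_coeff_def)
  moreover have "(\<Sum>j\<le>Suc K. of_real (kernel_coeff K j) * cis (pi * real j * t)) = cis (pi * t) * kernel_poly K t"
  proof -
    have "cis (pi * real (Suc j) * t) = cis (pi * t) * cis (pi * real j * t)" for j
      unfolding cis_mult by (rule arg_cong[of _ _ cis]) (simp add: algebra_simps)
    then show ?thesis unfolding sum.atMost_Suc_shift kernel_poly_def sum_distrib_left
      by (simp add: kernel_coeff_def[of _ 0] mult_ac)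
  qed
  ultimately show ?thesis
    by (simp only: of_real_diff left_diff_distrib sum_subtractf mult_1)
qed

lemma cmod_one_minus_cis: "(cmod (1 - cis (pi * t)))\<^sup>2 = 4 * (sin (pi * t / 2))\<^sup>2"
proof -
  have "(cmod (1 - cis (pi * t)))\<^sup>2 = (1 - cos (pi * t))\<^sup>2 + (sin (pi * t))\<^sup>2"
    by (simp add: cmod_power2)
  also have "\<dots> = 2 - 2 * cos (2 * (pi * t / 2))"
    by (simp add: sin_squared_eq power2_diff)
  finally have "(cmod (1 - cis (pi * t)))\<^sup>2 = 2 - 2 * cos (2 * (pi * t / 2))" .
  then show ?thesis unfolding cos_double_sin by simp
qed

text \<open>The squared modulus makes the weights nonnegative, and the denominator is their common
  sum before normalisation.\<close>

definition kernel_weight :: "nat \<Rightarrow> real \<Rightarrow> nat \<Rightarrow> real" where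
  "kernel_weight K x i = (cmod (kernel_poly K (x - grid (2 * K + 1) i)))\<^sup>2 / (real (2 * K + 1) * kernel_mass K)"

lemma kernel_weight_nonneg: "kernel_weight K x i \<ge> 0"
  using kernel_mass_pos[of K] by (simp add: kernel_weight_def)

lemma sum_kernel_weight: "(\<Sum>i=1..2 * K + 1. kernel_weight K x i) = 1"
proof -
  have "(\<Sum>i=1..2 * K + 1. (cmod (kernel_poly K (x - grid (2 * K + 1) i)))\<^sup>2) = real (2 * K + 1) * kernel_mass K"
    unfolding kernel_poly_def kernel_mass_def by (rule sum_cmod_squared_grid) simp
  then show ?thesis using kernel_mass_pos[of K]
    by (simp only: kernel_weight_def sum_divide_distrib[symmetric]) simp
qed

text \<open>The factor 4 sin^2 is \<bar>1 - cis\<bar>^2, so the discrete Parseval identity turns the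
  sum into that of the squared differences of the coefficients. With n = K + 2 there are n
  differences of size at most n, so 15 / n^2 arises as n^3 / (4 n^5 / 60).\<close>

lemma sum_kernel_weight_sin_squared:
  assumes "K \<ge> 1"
  shows "(\<Sum>i=1..2 * K + 1. kernel_weight K x i * (sin (pi * (x - grid (2 * K + 1) i) / 2))\<^sup>2) \<le> 15 / (real (K + 2))\<^sup>2"
proof -
  define n where "n = real (K + 2)"
  define L where "L = 2 * K + 1"
  define D where "D = (\<Sum>j\<le>Suc K. (kernel_coeff K (Suc j) - kernel_coeff K j)\<^sup>2)"
  have n: "n > 0" by (simp add: n_def)
  have "D \<le> (\<Sum>j\<le>Suc K. n\<^sup>2)" unfolding D_def
  proof (rule sum_mono)
    fix j assume "j \<in> {..Suc K}"
    then have "real j \<le> real K + 1" by simp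
    moreover have "kernel_coeff K (Suc j) - kernel_coeff K j = n - 2 * real j - 1"
      by (simp add: kernel_coeff_def n_def algebra_simps)
    ultimately have "\<bar>kernel_coeff K (Suc j) - kernel_coeff K j\<bar> \<le> n" by (simp add: n_def)
    then show "(kernel_coeff K (Suc j) - kernel_coeff K j)\<^sup>2 \<le> n\<^sup>2" by (simp add: abs_le_square_iff[symmetric])
  qed
  also have "\<dots> = n * n\<^sup>2" by (simp add: n_def)
  finally have D: "D \<le> n * n\<^sup>2" .
  \<comment> \<open>K \<ge> 1 makes the raised degree K + 1 smaller than the number 2 K + 1 of
    nodes.\<close>
  have "(\<Sum>i=1..L. (cmod (\<Sum>j\<le>Suc K. of_real (kernel_coeff K (Suc j) - kernel_coeff K j) * cis (pi * real j * (x - grid L i))))\<^sup>2) = real L * D"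
    unfolding D_def using assms by (intro sum_cmod_squared_grid) (simp add: L_def)
  then have "(\<Sum>i=1..L. 4 * (sin (pi * (x - grid L i) / 2))\<^sup>2 * (cmod (kernel_poly K (x - grid L i)))\<^sup>2) = real L * D"
    unfolding kernel_poly_diff[symmetric] norm_mult power_mult_distrib cmod_one_minus_cis .
  then have *: "(\<Sum>i=1..L. (cmod (kernel_poly K (x - grid L i)))\<^sup>2 * (sin (pi * (x - grid L i) / 2))\<^sup>2) = real L * D / 4"
    by (simp add: sum_distrib_left[symmetric] mult_ac)
  have "(\<Sum>i=1..L. kernel_weight K x i * (sin (pi * (x - grid L i) / 2))\<^sup>2) = real L * D / 4 / (real L * kernel_mass K)"
    unfolding kernel_weight_def L_def[symmetric] *[symmetric] sum_divide_distrib by simp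
  also have "\<dots> = D / (4 * kernel_mass K)" by (simp add: L_def)
  also have "\<dots> \<le> (n * n\<^sup>2) / (4 * (n ^ 5 / 60))"
    using D kernel_mass_ge[of K] n unfolding n_def[symmetric] by (intro frac_le) auto
  also have "\<dots> = 15 / n\<^sup>2" using n by (simp add: eval_nat_numeral)
  finally show ?thesis by (simp add: n_def L_def)
qed

text \<open>In place of Cauchy-Schwarz the pointwise bound \<bar>s\<bar> \<le> (n/2) s^2 + 1/(2n) is
  averaged; it is balanced so that both terms are of order 1/n, and 15/2 + 1/2 = 8.\<close>

lemma sum_kernel_weight_abs_sin:
  assumes "K \<ge> 1"
  shows "(\<Sum>i=1..2 * K + 1. kernel_weight K x i * \<bar>sin (pi * (x - grid (2 * K + 1) i) / 2)\<bar>) \<le> 8 / real (K + 2)"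
proof -
  define n where "n = real (K + 2)"
  define s where "s i = sin (pi * (x - grid (2 * K + 1) i) / 2)" for i
  have n: "n > 0" by (simp add: n_def)
  have "\<bar>s i\<bar> \<le> n / 2 * (s i)\<^sup>2 + 1 / (2 * n)" for i
  proof -
    have "0 \<le> (n * \<bar>s i\<bar> - 1)\<^sup>2 / (2 * n)" using n by simp
    also have "\<dots> = n / 2 * (s i)\<^sup>2 + 1 / (2 * n) - \<bar>s i\<bar>"
      using n by (simp add: power2_diff power_mult_distrib field_simps) (simp add: power2_eq_square)
    finally show ?thesis by simp
  qed
  then have "(\<Sum>i=1..2 * K + 1. kernel_weight K x i * \<bar>s i\<bar>)
      \<le> (\<Sum>i=1..2 * K + 1. kernel_weight K x i * (n / 2 * (s i)\<^sup>2 + 1 / (2 * n)))"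
    by (intro sum_mono mult_left_mono kernel_weight_nonneg)
  also have "\<dots> = (\<Sum>i=1..2 * K + 1. n / 2 * (kernel_weight K x i * (s i)\<^sup>2) + 1 / (2 * n) * kernel_weight K x i)"
    by (intro sum.cong refl) (simp add: algebra_simps)
  also have "\<dots> = n / 2 * (\<Sum>i=1..2 * K + 1. kernel_weight K x i * (s i)\<^sup>2) + 1 / (2 * n) * 1"
    by (simp only: sum.distrib sum_distrib_left[symmetric] sum_kernel_weight)
  also have "\<dots> \<le> n / 2 * (15 / n\<^sup>2) + 1 / (2 * n) * 1"
    using sum_kernel_weight_sin_squared[OF assms, of x] n
    by (intro add_right_mono mult_left_mono) (simp_all add: s_def n_def)
  also have "\<dots> = 8 / n" using n by (simp add: power2_eq_square field_simps)
  finally show ?thesis by (simp add: s_def n_def)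
qed

section \<open>Lipschitz bounds on the circle and the Jackson operator\<close>

text \<open>Jordan's inequality: the concave sine lies above its chord from 0 to pi / 2.\<close>

lemma sin_pi_half_ge:
  assumes "0 \<le> d" "d \<le> 1"
  shows "d \<le> sin (pi * d / 2)"
proof -
  have "concave_on {0..pi} sin"
    by (rule f''_le0_imp_concave[where f'=cos and f''="\<lambda>x. - sin x"])
       (auto intro!: derivative_eq_intros sin_ge_zero)
  from concave_onD[OF this assms, of 0 "pi / 2"] show ?thesis by (simp add: mult_ac)
qed

text \<open>The left-hand side is the distance of d from the even integers, that is, the distance on
  a circle of length 2.\<close>

lemma abs_sin_pi_half_ge: "\<bar>d\<bar> \<le> 2 \<Longrightarrow> min \<bar>d\<bar> (2 - \<bar>d\<bar>) \<le> \<bar>sin (pi * d / 2)\<bar>"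
proof -
  assume d: "\<bar>d\<bar> \<le> 2"
  have "\<bar>sin (pi * d / 2)\<bar> = \<bar>sin (pi * \<bar>d\<bar> / 2)\<bar>" by (cases "d \<ge> 0") simp_all
  moreover have "\<bar>sin (pi * \<bar>d\<bar> / 2)\<bar> = \<bar>sin (pi * (2 - \<bar>d\<bar>) / 2)\<bar>"
  proof -
    have "pi * (2 - \<bar>d\<bar>) / 2 = pi - pi * \<bar>d\<bar> / 2" by (simp add: field_simps)
    then show ?thesis by (simp only: sin_pi_minus)
  qed
  ultimately show ?thesis
    using sin_pi_half_ge[of "\<bar>d\<bar>"] sin_pi_half_ge[of "2 - \<bar>d\<bar>"] d
    by (cases "\<bar>d\<bar> \<le> 1") (auto intro: order_trans[OF _ abs_ge_self])
qed

text \<open>A function vanishing at both ends of the interval may be regarded as periodic.\<close>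

lemma lipschitz_imp_sin_bound:
  fixes g :: "real \<Rightarrow> complex"
  assumes lip: "\<And>s t. s \<in> {-1..1} \<Longrightarrow> t \<in> {-1..1} \<Longrightarrow> cmod (g s - g t) \<le> B * \<bar>s - t\<bar>"
    and "g (-1) = 0" "g 1 = 0" "B \<ge> 0" "s \<in> {-1..1}" "t \<in> {-1..1}"
  shows "cmod (g s - g t) \<le> B * \<bar>sin (pi * (s - t) / 2)\<bar>"
proof -
  \<comment> \<open>The way around: from s to -1 and from 1 to t, as g vanishes at both
    ends.\<close>
  have wrap: "cmod (g s - g t) \<le> B * (2 - \<bar>s - t\<bar>)" if st: "s \<in> {-1..1}" "t \<in> {-1..1}" "s \<le> t" for s t
  proof -
    have "cmod (g s) \<le> B * (s + 1)" using lip[of s "-1"] st assms by auto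
    moreover have "cmod (g t) \<le> B * (1 - t)" using lip[of t 1] st assms by auto
    moreover have "cmod (g s - g t) \<le> cmod (g s) + cmod (g t)" by (rule norm_triangle_ineq4)
    ultimately have "cmod (g s - g t) \<le> B * (s + 1) + B * (1 - t)" by linarith
    also have "\<dots> = B * (2 - \<bar>s - t\<bar>)" using st by (simp add: algebra_simps)
    finally show ?thesis .
  qed
  have "cmod (g s - g t) \<le> B * (2 - \<bar>s - t\<bar>)"
    using wrap[of s t] wrap[of t s] assms by (cases "s \<le> t") (auto simp: norm_minus_commute abs_minus_commute)
  moreover have "cmod (g s - g t) \<le> B * \<bar>s - t\<bar>" using lip assms by blast
  ultimately have "cmod (g s - g t) \<le> B * min \<bar>s - t\<bar> (2 - \<bar>s - t\<bar>)" by (simp add: min_def)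
  also have "\<dots> \<le> B * \<bar>sin (pi * (s - t) / 2)\<bar>"
    using assms by (intro mult_left_mono abs_sin_pi_half_ge) auto
  finally show ?thesis .
qed

text \<open>Convolution with a product kernel, with the integral replaced by the grid sum: at every
  point a weighted mean of the grid values of \<open>f\<close>.\<close>

definition jackson :: "nat \<Rightarrow> (real \<times> real \<Rightarrow> complex) \<Rightarrow> real \<times> real \<Rightarrow> complex" where
  "jackson K f p = (\<Sum>i=1..2 * K + 1. \<Sum>j=1..2 * K + 1.
     of_real (kernel_weight K (fst p) i * kernel_weight K (snd p) j) * f (grid (2 * K + 1) i, grid (2 * K + 1) j))"

text \<open>Nonnegative weights of sum 1 make the error a weighted mean of f(node) - f(p). Changing
  one coordinate at a time bounds this difference by sines, whose weighted means are at most 8 / (K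
  + 2) in each direction.\<close>

lemma jackson_approximation:
  assumes K: "K \<ge> 1" and B: "B \<ge> 0"
    and lip: "\<And>p q. p \<in> unit_square \<Longrightarrow> q \<in> unit_square \<Longrightarrow> cmod (f p - f q) \<le> B * (\<bar>fst p - fst q\<bar> + \<bar>snd p - snd q\<bar>)"
    and zero: "\<And>p. norm p \<ge> 1 \<Longrightarrow> f p = 0"
    and p: "p \<in> unit_square"
  shows "cmod (jackson K f p - f p) \<le> 16 * B / real (K + 2)"
proof -
  obtain x y where xy: "p = (x, y)" by force
  define L where "L = 2 * K + 1"
  define g where "g = grid L"
  have g: "g i \<in> {-1..1}" if "i \<in> {1..L}" for i using grid_bounds[OF that] by (simp add: g_def)
  have x: "x \<in> {-1..1}" "y \<in> {-1..1}" using p by (auto simp: xy)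
  \<comment> \<open>The sides of the square lie outside the open disk. This licenses the periodic
    Lipschitz bound in either variable.\<close>
  have edge: "f (a, b) = 0" if "\<bar>a\<bar> = 1 \<or> \<bar>b\<bar> = 1" for a b
  proof (rule zero)
    show "norm (a, b) \<ge> 1" using that norm_fst_le[of a b] norm_snd_le[of b a] by auto
  qed
  have bnd: "cmod (f (a, b) - f (x, y)) \<le> B * (\<bar>sin (pi * (x - a) / 2)\<bar> + \<bar>sin (pi * (y - b) / 2)\<bar>)"
    if ab: "a \<in> {-1..1}" "b \<in> {-1..1}" for a b
  proof -
    have "cmod (f (x, b) - f (a, b)) \<le> B * \<bar>sin (pi * (x - a) / 2)\<bar>"
    proof (rule lipschitz_imp_sin_bound[of "\<lambda>t. f (t, b)"])
      fix s t :: real assume "s \<in> {-1..1}" "t \<in> {-1..1}"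
      then show "cmod (f (s, b) - f (t, b)) \<le> B * \<bar>s - t\<bar>" using lip[of "(s, b)" "(t, b)"] ab by simp
    qed (use edge B x ab in auto)
    moreover have "cmod (f (x, y) - f (x, b)) \<le> B * \<bar>sin (pi * (y - b) / 2)\<bar>"
    proof (rule lipschitz_imp_sin_bound[of "\<lambda>t. f (x, t)"])
      fix s t :: real assume "s \<in> {-1..1}" "t \<in> {-1..1}"
      then show "cmod (f (x, s) - f (x, t)) \<le> B * \<bar>s - t\<bar>" using lip[of "(x, s)" "(x, t)"] x by simp
    qed (use edge B x ab in auto)
    moreover have "cmod (f (a, b) - f (x, y)) \<le> cmod (f (x, b) - f (a, b)) + cmod (f (x, y) - f (x, b))"
      using norm_triangle_ineq[of "f (x, b) - f (a, b)" "f (x, y) - f (x, b)"] by (simp add: norm_minus_commute)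
    ultimately show ?thesis by (simp add: distrib_left)
  qed
  define w where "w i = kernel_weight K x i" for i
  define v where "v j = kernel_weight K y j" for j
  define s where "s i = \<bar>sin (pi * (x - g i) / 2)\<bar>" for i
  define t where "t j = \<bar>sin (pi * (y - g j) / 2)\<bar>" for j
  have w1: "(\<Sum>i=1..L. w i) = 1" and v1: "(\<Sum>j=1..L. v j) = 1"
    by (simp_all only: w_def v_def L_def sum_kernel_weight)
  have ws: "(\<Sum>i=1..L. w i * s i) \<le> 8 / real (K + 2)" and vt: "(\<Sum>j=1..L. v j * t j) \<le> 8 / real (K + 2)"
    unfolding w_def v_def s_def t_def g_def L_def by (rule sum_kernel_weight_abs_sin[OF K])+
  have wv: "w i \<ge> 0" "v j \<ge> 0" for i j by (simp_all add: w_def v_def kernel_weight_nonneg)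
  have "(\<Sum>i=1..L. \<Sum>j=1..L. complex_of_real (w i * v j) * f p) = of_real ((\<Sum>i=1..L. w i) * (\<Sum>j=1..L. v j)) * f p"
    unfolding sum_product[of w "{1..L}" v] unfolding of_real_sum sum_distrib_right ..
  then have "jackson K f p - f p = (\<Sum>i=1..L. \<Sum>j=1..L. of_real (w i * v j) * (f (g i, g j) - f p))"
    unfolding w1 v1 by (simp add: jackson_def xy right_diff_distrib sum_subtractf w_def v_def g_def L_def)
  also have "cmod \<dots> \<le> (\<Sum>i=1..L. \<Sum>j=1..L. cmod (of_real (w i * v j) * (f (g i, g j) - f p)))"
    by (intro order_trans[OF norm_sum] sum_mono norm_sum)
  also have "\<dots> \<le> (\<Sum>i=1..L. \<Sum>j=1..L. (w i * v j) * (B * (s i + t j)))"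
  proof (intro sum_mono)
    fix i j assume "i \<in> {1..L}" "j \<in> {1..L}"
    then have "cmod (f (g i, g j) - f p) \<le> B * (s i + t j)"
      using bnd[OF g g] by (simp add: xy s_def t_def)
    then show "cmod (of_real (w i * v j) * (f (g i, g j) - f p)) \<le> (w i * v j) * (B * (s i + t j))"
      unfolding norm_mult norm_of_real using wv by (auto intro!: mult_mono simp: abs_mult)
  qed
  also have "\<dots> = B * ((\<Sum>i=1..L. w i * s i) * (\<Sum>j=1..L. v j) + (\<Sum>i=1..L. w i) * (\<Sum>j=1..L. v j * t j))"
    unfolding sum_product unfolding sum.distrib[symmetric] unfolding sum_distrib_left
    by (intro sum.cong refl) (simp add: algebra_simps)
  also have "\<dots> \<le> B * (8 / real (K + 2) + 8 / real (K + 2))"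
    unfolding w1 v1 using ws vt B by (intro mult_left_mono) auto
  finally show ?thesis by (simp add: mult.commute)
qed

section \<open>The Jackson approximation as a trigonometric polynomial\<close>

definition trig_poly :: "nat \<Rightarrow> (real \<times> real \<Rightarrow> complex) \<Rightarrow> bool" where
  "trig_poly K F \<longleftrightarrow> (\<exists>s. F = (\<lambda>p. \<Sum>k\<in>freq_box K. s k * wave k p))"

lemma trig_poly_wave:
  assumes "k \<in> freq_box K"
  shows "trig_poly K (\<lambda>p. c * wave k p)"
proof -
  have "(\<Sum>l\<in>freq_box K. (if l = k then c else 0) * wave l p) = c * wave k p" for p
    using assms finite_freq_box by (simp add: if_distrib[of "\<lambda>a. a * _"] cong: if_cong)
  then show ?thesis unfolding trig_poly_def by (intro exI[of _ "\<lambda>l. if l = k then c else 0"]) simp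
qed

lemma trig_poly_sum:
  assumes "\<And>i. i \<in> I \<Longrightarrow> trig_poly K (F i)"
  shows "trig_poly K (\<lambda>p. \<Sum>i\<in>I. F i p)"
proof -
  have "\<forall>i\<in>I. \<exists>s. F i = (\<lambda>p. \<Sum>k\<in>freq_box K. s k * wave k p)"
    using assms unfolding trig_poly_def by blast
  from bchoice[OF this] obtain s where s: "\<And>i. i \<in> I \<Longrightarrow> F i = (\<lambda>p. \<Sum>k\<in>freq_box K. s i k * wave k p)"
    by blast
  have "(\<lambda>p. \<Sum>i\<in>I. F i p) = (\<lambda>p. \<Sum>k\<in>freq_box K. (\<Sum>i\<in>I. s i k) * wave k p)"
    by (rule ext) (simp add: s sum_distrib_right sum.swap[of _ I])
  then show ?thesis unfolding trig_poly_def by (intro exI[of _ "\<lambda>k. \<Sum>i\<in>I. s i k"])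
qed

text \<open>The squared modulus of a sum with frequencies 0 to K has frequencies j - l between -K
  and K, which is just what \<open>freq_box K\<close> admits.\<close>

lemma kernel_weight_expand:
  "\<exists>c. \<forall>x. complex_of_real (kernel_weight K x i)
     = (\<Sum>u\<in>{..K} \<times> {..K}. c u * cis (pi * of_int (int (fst u) - int (snd u)) * x))"
proof (intro exI allI)
  fix x
  define g where "g = grid (2 * K + 1) i"
  define N where "N = real (2 * K + 1) * kernel_mass K"
  have "complex_of_real (kernel_weight K x i) = (kernel_poly K (x - g) * cnj (kernel_poly K (x - g))) / of_real N"
    unfolding kernel_weight_def g_def[symmetric] N_def[symmetric] of_real_divide complex_norm_square ..
  also have "\<dots> = (\<Sum>j\<le>K. \<Sum>l\<le>K. of_real (kernel_coeff K (Suc j) * kernel_coeff K (Suc l) / N) *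
     cis (- (pi * (real j - real l) * g)) * cis (pi * of_int (int j - int l) * x))"
    unfolding kernel_poly_def cnj_sum sum_product sum_divide_distrib
  proof (intro sum.cong refl)
    fix j l
    have "cis (pi * real j * (x - g)) * cis (- (pi * real l * (x - g))) = cis (- (pi * (real j - real l) * g)) * cis (pi * of_int (int j - int l) * x)"
      unfolding cis_mult by (rule arg_cong[of _ _ cis]) (simp add: algebra_simps)
    then have "of_real (kernel_coeff K (Suc j)) * of_real (kernel_coeff K (Suc l)) * (cis (pi * real j * (x - g)) * cis (- (pi * real l * (x - g)))) / of_real N
       = complex_of_real (kernel_coeff K (Suc j)) * of_real (kernel_coeff K (Suc l)) * (cis (- (pi * (real j - real l) * g)) * cis (pi * of_int (int j - int l) * x)) / of_real N"
      by (simp only:)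
    then show "complex_of_real (kernel_coeff K (Suc j)) * cis (pi * real j * (x - g)) * cnj (complex_of_real (kernel_coeff K (Suc l)) * cis (pi * real l * (x - g))) / of_real N
      = of_real (kernel_coeff K (Suc j) * kernel_coeff K (Suc l) / N) * cis (- (pi * (real j - real l) * g)) * cis (pi * of_int (int j - int l) * x)"
      by (simp only: complex_cnj_mult complex_cnj_complex_of_real cis_cnj of_real_mult of_real_divide mult_ac times_divide_eq_left times_divide_eq_right)
  qed
  also have "\<dots> = (\<Sum>u\<in>{..K} \<times> {..K}. (of_real (kernel_coeff K (Suc (fst u)) * kernel_coeff K (Suc (snd u)) / N) *
     cis (- (pi * (real (fst u) - real (snd u)) * g))) * cis (pi * of_int (int (fst u) - int (snd u)) * x))"
    by (simp only: sum.cartesian_product' fst_conv snd_conv)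
  finally show "complex_of_real (kernel_weight K x i) = (\<Sum>u\<in>{..K} \<times> {..K}.
     (\<lambda>u. of_real (kernel_coeff K (Suc (fst u)) * kernel_coeff K (Suc (snd u)) / (real (2 * K + 1) * kernel_mass K)) *
     cis (- (pi * (real (fst u) - real (snd u)) * grid (2 * K + 1) i))) u * cis (pi * of_int (int (fst u) - int (snd u)) * x))"
    by (simp only: g_def N_def)
qed

lemma trig_poly_jackson: "trig_poly K (jackson K f)"
proof -
  let ?T = "{..K} \<times> {..K}"
  define d where "d u = int (fst u) - int (snd u)" for u :: "nat \<times> nat"
  have "\<forall>i. \<exists>c. \<forall>x. complex_of_real (kernel_weight K x i) = (\<Sum>u\<in>?T. c u * cis (pi * of_int (d u) * x))"
    unfolding d_def by (intro allI kernel_weight_expand)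
  from choice[OF this] obtain c where c: "\<And>i x. complex_of_real (kernel_weight K x i) = (\<Sum>u\<in>?T. c i u * cis (pi * of_int (d u) * x))"
    by blast
  have "complex_of_real (kernel_weight K (fst p) i * kernel_weight K (snd p) j) * y
       = (\<Sum>u\<in>?T. \<Sum>v\<in>?T. (c i u * c j v * y) * wave (d u, d v) p)" for i j y p
  proof -
    have "complex_of_real (kernel_weight K (fst p) i * kernel_weight K (snd p) j) * y
       = (\<Sum>u\<in>?T. \<Sum>v\<in>?T. (c i u * cis (pi * of_int (d u) * fst p)) * (c j v * cis (pi * of_int (d v) * snd p)) * y)"
      unfolding of_real_mult c unfolding sum_product unfolding sum_distrib_right ..
    also have "\<dots> = (\<Sum>u\<in>?T. \<Sum>v\<in>?T. (c i u * c j v * y) * wave (d u, d v) p)"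
    proof (intro sum.cong refl)
      fix u v
      have "wave (d u, d v) p = cis (pi * of_int (d u) * fst p) * cis (pi * of_int (d v) * snd p)"
        by (simp add: wave_def cis_mult algebra_simps)
      then show "(c i u * cis (pi * of_int (d u) * fst p)) * (c j v * cis (pi * of_int (d v) * snd p)) * y = (c i u * c j v * y) * wave (d u, d v) p"
        by (simp only: mult_ac)
    qed
    finally show ?thesis .
  qed
  then have "jackson K f = (\<lambda>p. \<Sum>i=1..2 * K + 1. \<Sum>j=1..2 * K + 1. \<Sum>u\<in>?T. \<Sum>v\<in>?T.
      (c i u * c j v * f (grid (2 * K + 1) i, grid (2 * K + 1) j)) * wave (d u, d v) p)"
    unfolding jackson_def[abs_def] by (simp only:)
  moreover have "trig_poly K (\<lambda>p. \<Sum>i=1..2 * K + 1. \<Sum>j=1..2 * K + 1. \<Sum>u\<in>?T. \<Sum>v\<in>?T.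
      (c i u * c j v * f (grid (2 * K + 1) i, grid (2 * K + 1) j)) * wave (d u, d v) p)"
    by (intro trig_poly_sum trig_poly_wave) (auto simp: d_def)
  ultimately show ?thesis by simp
qed

section \<open>Convergence of the finite Fourier-Bessel transform\<close>

lemma content_unit_square: "measure lborel unit_square = 4"
  by (simp add: content_Pair)

text \<open>The mode lives on the disk while Parseval holds on the square; enlarging the domain at
  this point connects the two.\<close>

lemma cmod_integral_bessel_mode_le:
  assumes h: "continuous_on UNIV h" and B: "\<And>p. cmod (bessel_mode z m p) \<le> B"
  shows "cmod (\<integral>p. bessel_mode z m p * h p \<partial>lborel) \<le> B * integral unit_square (\<lambda>p. cmod (h p))"
proof -
  have [measurable]: "h \<in> borel_measurable borel" by (rule borel_measurable_continuous_onI[OF h])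
  have ch: "continuous_on unit_square (\<lambda>p. cmod (h p))"
    by (intro continuous_intros continuous_on_subset[OF h]) simp
  obtain C where C: "\<forall>p\<in>unit_square. cmod (h p) \<le> C"
    using compact_imp_bounded[OF compact_continuous_image[OF continuous_on_subset[OF h subset_UNIV] compact_cbox]]
    unfolding bounded_iff by (metis image_eqI)
  have sub: "p \<in> unit_square" if "norm p < 1" for p :: "real \<times> real"
    using norm_fst_le[of "fst p" "snd p"] norm_snd_le[of "snd p" "fst p"] that by (cases p) (auto simp: abs_le_iff)
  have int: "integrable lborel (\<lambda>p. bessel_mode z m p * h p)"
    using C sub by (intro integrable_bessel_mode_mult[where C=C]) auto
  have ints: "integrable lborel (\<lambda>p. indicator unit_square p *\<^sub>R cmod (h p))"
    by (rule borel_integrable_compact[OF compact_cbox ch])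
  have "cmod (\<integral>p. bessel_mode z m p * h p \<partial>lborel) \<le> (\<integral>p. cmod (bessel_mode z m p * h p) \<partial>lborel)"
    by (rule integral_norm_bound)
  also have "\<dots> \<le> (\<integral>p. B * (indicator unit_square p *\<^sub>R cmod (h p)) \<partial>lborel)"
  proof (rule integral_mono)
    show "integrable lborel (\<lambda>p. cmod (bessel_mode z m p * h p))" using int by (rule integrable_norm)
    show "integrable lborel (\<lambda>p. B * (indicator unit_square p *\<^sub>R cmod (h p)))" using ints by (rule integrable_mult_right)
    fix p
    show "cmod (bessel_mode z m p * h p) \<le> B * (indicator unit_square p *\<^sub>R cmod (h p))"
    proof (cases "norm p < 1")
      case True
      then show ?thesis using sub[OF True] B[of p] by (simp add: norm_mult mult_right_mono)
    next
      case False
      then have "bessel_mode z m p = 0" by (simp add: bessel_mode_def)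
      moreover have "B \<ge> 0" using B[of p] norm_ge_zero order_trans by blast
      ultimately show ?thesis by simp
    qed
  qed
  also have "\<dots> = B * (LINT p:unit_square|lborel. cmod (h p))"
    by (simp add: set_lebesgue_integral_def)
  also have "(LINT p:unit_square|lborel. cmod (h p)) = integral unit_square (\<lambda>p. cmod (h p))"
    using ints by (intro set_borel_integral_eq_integral) (simp add: set_integrable_def)
  finally show ?thesis .
qed

text \<open>The constant comes from \<open>2\<epsilon>\<bar>h\<bar> \<le> \<bar>h\<bar>\<^sup>2 + \<epsilon>\<^sup>2\<close>, integrated over the square of area \<open>4\<close>.\<close>

lemma cmod_integral_bessel_mode_trig_poly_le:
  assumes F: "finite F" "(\<Sum>k\<in>F. (cmod (b k))\<^sup>2) \<le> 16 * \<epsilon>\<^sup>2" and \<epsilon>: "\<epsilon> > 0"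
    and B: "\<And>p. cmod (bessel_mode z m p) \<le> B"
  shows "cmod (\<integral>p. bessel_mode z m p * (\<Sum>k\<in>F. b k * wave k p) \<partial>lborel) \<le> B * (34 * \<epsilon>)"
proof -
  define h where "h p = (\<Sum>k\<in>F. b k * wave k p)" for p
  have cont: "continuous_on A h" for A unfolding h_def by (intro continuous_intros)
  have B0: "B \<ge> 0" using B[of 0] norm_ge_zero order_trans by blast
  have "integral unit_square (\<lambda>p. cmod (h p)) \<le> integral unit_square (\<lambda>p. 1 / (2 * \<epsilon>) * (cmod (h p))\<^sup>2 + \<epsilon> / 2)"
  proof (rule integral_le)
    fix p
    have "0 \<le> (cmod (h p) - \<epsilon>)\<^sup>2 / (2 * \<epsilon>)" using \<epsilon> by simp
    also have "\<dots> = 1 / (2 * \<epsilon>) * (cmod (h p))\<^sup>2 + \<epsilon> / 2 - cmod (h p)"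
      using \<epsilon> by (simp add: power2_diff field_simps) (simp add: power2_eq_square)
    finally show "cmod (h p) \<le> 1 / (2 * \<epsilon>) * (cmod (h p))\<^sup>2 + \<epsilon> / 2" by simp
  qed (intro integrable_continuous continuous_intros cont)+
  also have "\<dots> = 1 / (2 * \<epsilon>) * integral unit_square (\<lambda>p. (cmod (h p))\<^sup>2) + 4 * (\<epsilon> / 2)"
  proof -
    have 1: "(\<lambda>p. 1 / (2 * \<epsilon>) * (cmod (h p))\<^sup>2) integrable_on unit_square"
      and 2: "(\<lambda>p. \<epsilon> / 2) integrable_on unit_square"
      by (intro integrable_continuous continuous_intros cont)+
    show ?thesis
      unfolding integral_add[OF 1 2] integral_mult_right by (simp add: content_unit_square)
  qed
  also have "integral unit_square (\<lambda>p. (cmod (h p))\<^sup>2) = 4 * (\<Sum>k\<in>F. (cmod (b k))\<^sup>2)"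
    unfolding h_def by (rule integral_cmod_trig_poly_squared[OF F(1)])
  also have "1 / (2 * \<epsilon>) * (4 * (\<Sum>k\<in>F. (cmod (b k))\<^sup>2)) + 4 * (\<epsilon> / 2) \<le> 1 / (2 * \<epsilon>) * (4 * (16 * \<epsilon>\<^sup>2)) + 4 * (\<epsilon> / 2)"
    using F(2) \<epsilon> by (intro add_right_mono mult_left_mono) auto
  also have "\<dots> = 34 * \<epsilon>" using \<epsilon> by (simp add: power2_eq_square)
  finally have "integral unit_square (\<lambda>p. cmod (h p)) \<le> 34 * \<epsilon>" .
  then have "B * integral unit_square (\<lambda>p. cmod (h p)) \<le> B * (34 * \<epsilon>)" using B0 by (rule mult_left_mono)
  with cmod_integral_bessel_mode_le[OF cont B] show ?thesis unfolding h_def by (rule order_trans)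
qed

text \<open>The sum under the integral is 4 times the trigonometric polynomial that interpolates
  \<open>f\<close> on the grid, the 4 being the area carried by
  \<open>finite_fourier\<close>.\<close>

lemma fourier_bessel_eq_integral:
  assumes \<kappa>: "\<And>k. coeff_c k m n = \<kappa> * (\<integral>p. bessel_mode z m p * wave k p \<partial>lborel)"
  shows "fourier_bessel K m n f =
    \<kappa> * (\<integral>p. bessel_mode z m p * (\<Sum>k\<in>freq_box K. finite_fourier f (2 * K + 1) k * wave k p) \<partial>lborel)"
proof -
  have int: "integrable lborel (\<lambda>p. bessel_mode z m p * wave k p)" for k
    by (rule integrable_bessel_mode_mult[where C=1]) auto
  have "(\<integral>p. bessel_mode z m p * (\<Sum>k\<in>freq_box K. finite_fourier f (2 * K + 1) k * wave k p) \<partial>lborel)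
     = (\<integral>p. (\<Sum>k\<in>freq_box K. finite_fourier f (2 * K + 1) k * (bessel_mode z m p * wave k p)) \<partial>lborel)"
    by (simp add: sum_distrib_left mult_ac)
  also have "\<dots> = (\<Sum>k\<in>freq_box K. finite_fourier f (2 * K + 1) k * (\<integral>p. bessel_mode z m p * wave k p \<partial>lborel))"
    by (subst Bochner_Integration.integral_sum) (auto intro!: integrable_mult_right int)
  finally show ?thesis
    by (simp add: fourier_bessel_def \<kappa> sum_distrib_left mult_ac)
qed

lemma finite_fourier_diff:
  "finite_fourier (\<lambda>p. f p - g p) L k = finite_fourier f L k - finite_fourier g L k"
  by (simp add: finite_fourier_eq left_diff_distrib sum_subtractf right_diff_distrib)

lemma fourier_bessel_diff:
  "fourier_bessel K m n (\<lambda>p. f p - g p) = fourier_bessel K m n f - fourier_bessel K m n g"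
  by (simp add: fourier_bessel_def finite_fourier_diff right_diff_distrib sum_subtractf)

text \<open>Split f into S = \<open>jackson K f\<close> and the rest. On S the transform equals the
  limit functional, because interpolation reproduces S; on f - S both are O(1/K), the transform by
  its L^2 bound and the functional by the supremum.\<close>

lemma fourier_bessel_approximation:
  assumes \<kappa>: "\<And>k. coeff_c k m n = \<kappa> * (\<integral>p. bessel_mode z m p * wave k p \<partial>lborel)"
    and cont: "continuous_on UNIV f" and B: "B > 0"
    and lip: "\<And>p q. p \<in> unit_square \<Longrightarrow> q \<in> unit_square \<Longrightarrow> cmod (f p - f q) \<le> B * (\<bar>fst p - fst q\<bar> + \<bar>snd p - snd q\<bar>)"
    and zero: "\<And>p. norm p \<ge> 1 \<Longrightarrow> f p = 0"
  obtains A where "A \<ge> 0" and "\<And>K. K \<ge> 1 \<Longrightarrow>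
    cmod (fourier_bessel K m n f - 4 * \<kappa> * (\<integral>p. bessel_mode z m p * f p \<partial>lborel)) \<le> A / real K"
proof -
  obtain W where W: "W > 0" "\<And>p. cmod (bessel_mode z m p) \<le> W" using bessel_mode_bounded by blast
  \<comment> \<open>800 = 16 * 50: errors are measured in \<epsilon> = 16 B / (K + 2), the transform
    of f - S costs 34 of them and the functional 4 * 4, the factor in 4 \<kappa> times the area of
    the square.\<close>
  have bound: "cmod (fourier_bessel K m n f - 4 * \<kappa> * (\<integral>p. bessel_mode z m p * f p \<partial>lborel)) \<le> 800 * cmod \<kappa> * W * B / real K"
    if K: "K \<ge> 1" for K
  proof -
    define S where "S = jackson K f"
    define \<epsilon> where "\<epsilon> = 16 * B / real (K + 2)"
    have \<epsilon>: "\<epsilon> > 0" using B by (simp add: \<epsilon>_def)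
    have approx: "cmod (f p - S p) \<le> \<epsilon>" if "p \<in> unit_square" for p
      using jackson_approximation[OF K less_imp_le[OF B] lip zero that]
      by (simp add: S_def \<epsilon>_def norm_minus_commute)
    obtain s where s: "S = (\<lambda>p. \<Sum>k\<in>freq_box K. s k * wave k p)"
      using trig_poly_jackson[of K f] unfolding trig_poly_def S_def by blast
    have contS: "continuous_on A S" for A unfolding s by (intro continuous_intros)
    have contD: "continuous_on UNIV (\<lambda>p. f p - S p)" by (intro continuous_intros cont contS)
    have b1: "cmod (fourier_bessel K m n (\<lambda>p. f p - S p)) \<le> cmod \<kappa> * (W * (34 * \<epsilon>))"
      unfolding fourier_bessel_eq_integral[OF \<kappa>] norm_mult
    proof (intro mult_left_mono cmod_integral_bessel_mode_trig_poly_le finite_freq_box sum_finite_fourier_le)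
      fix p assume "p \<in> grid_points (2 * K + 1)"
      then have "p \<in> unit_square" using grid_bounds[of _ "2 * K + 1"] by (auto simp del: One_nat_def)
      then show "cmod (f p - S p) \<le> \<epsilon>" by (rule approx)
    qed (use W \<epsilon> in auto)
    have fS: "fourier_bessel K m n S = 4 * \<kappa> * (\<integral>p. bessel_mode z m p * S p \<partial>lborel)"
    proof -
      have "(\<Sum>k\<in>freq_box K. finite_fourier S (2 * K + 1) k * wave k p) = 4 * S p" for p
      proof -
        have "(\<Sum>k\<in>freq_box K. finite_fourier S (2 * K + 1) k * wave k p) = (\<Sum>k\<in>freq_box K. 4 * (s k * wave k p))"
          unfolding s by (intro sum.cong refl) (simp only: finite_fourier_trig_poly mult.assoc)
        then show ?thesis by (simp add: s sum_distrib_left)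
      qed
      then have "fourier_bessel K m n S = \<kappa> * (\<integral>p. 4 * (bessel_mode z m p * S p) \<partial>lborel)"
        unfolding fourier_bessel_eq_integral[OF \<kappa>] by (simp only: mult.left_commute[of _ 4])
      then show ?thesis unfolding integral_mult_right_zero by (simp only: mult_ac)
    qed
    have SD: "(\<integral>p. bessel_mode z m p * S p \<partial>lborel) - (\<integral>p. bessel_mode z m p * f p \<partial>lborel)
       = - (\<integral>p. bessel_mode z m p * (f p - S p) \<partial>lborel)"
    proof -
      have int: "integrable lborel (\<lambda>p. bessel_mode z m p * h p)" if h: "continuous_on UNIV h" for h
      proof -
        obtain C where "\<forall>p\<in>cball 0 1. cmod (h p) \<le> C"
          using compact_imp_bounded[OF compact_continuous_image[OF continuous_on_subset[OF h subset_UNIV] compact_cball[of 0 1]]]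
          unfolding bounded_iff by (metis image_eqI)
        then show ?thesis
          by (intro integrable_bessel_mode_mult[where C=C] borel_measurable_continuous_onI[OF h]) auto
      qed
      show ?thesis using Bochner_Integration.integral_diff[OF int[OF cont] int[OF contS]]
        by (simp add: right_diff_distrib)
    qed
    have b2: "cmod (\<integral>p. bessel_mode z m p * (f p - S p) \<partial>lborel) \<le> W * (4 * \<epsilon>)"
    proof -
      have "integral unit_square (\<lambda>p. cmod (f p - S p)) \<le> integral unit_square (\<lambda>p. \<epsilon>)"
        by (intro integral_le integrable_continuous continuous_intros continuous_on_subset[OF cont] contS approx) auto
      also have "\<dots> = 4 * \<epsilon>" by (simp add: content_unit_square)
      finally have "W * integral unit_square (\<lambda>p. cmod (f p - S p)) \<le> W * (4 * \<epsilon>)"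
        using W(1) by (intro mult_left_mono) auto
      with cmod_integral_bessel_mode_le[OF contD W(2)] show ?thesis by (rule order_trans)
    qed
    have eq: "fourier_bessel K m n f - 4 * \<kappa> * (\<integral>p. bessel_mode z m p * f p \<partial>lborel)
       = fourier_bessel K m n (\<lambda>p. f p - S p) + 4 * \<kappa> * - (\<integral>p. bessel_mode z m p * (f p - S p) \<partial>lborel)"
      unfolding SD[symmetric] fourier_bessel_diff fS by (simp add: right_diff_distrib)
    have "cmod (4 * \<kappa> * - (\<integral>p. bessel_mode z m p * (f p - S p) \<partial>lborel)) \<le> 4 * cmod \<kappa> * (W * (4 * \<epsilon>))"
      unfolding norm_mult norm_minus_cancel using b2 by (intro mult_mono) auto
    then have "cmod (fourier_bessel K m n f - 4 * \<kappa> * (\<integral>p. bessel_mode z m p * f p \<partial>lborel))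
        \<le> cmod \<kappa> * (W * (34 * \<epsilon>)) + 4 * cmod \<kappa> * (W * (4 * \<epsilon>))"
      unfolding eq using b1 by (intro order_trans[OF norm_triangle_ineq] add_mono)
    also have "\<dots> = 50 * cmod \<kappa> * W * \<epsilon>" by (simp add: algebra_simps)
    also have "\<dots> \<le> 50 * cmod \<kappa> * W * (16 * B / real K)"
      using W(1) B K unfolding \<epsilon>_def by (intro mult_left_mono divide_left_mono) auto
    finally show ?thesis by (simp add: mult_ac)
  qed
  show thesis
    by (rule that[OF _ bound]) (use W(1) B in auto)
qed

section \<open>Equivariance of the limit and the rotated function\<close>

text \<open>Invariance of the measure moves the rotation from \<open>f\<close> to the mode, where it
  becomes the inverse rotation; this turns the phase e^(-i m t) of
  \<open>bessel_mode_rotation\<close> into e^(i m \<phi>).\<close>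

lemma integral_bessel_mode_rotate_fun:
  assumes [measurable]: "f \<in> borel_measurable borel"
  shows "(\<integral>p. bessel_mode z m p * rotate_fun \<phi> f p \<partial>lborel)
     = cis (of_int m * \<phi>) * (\<integral>p. bessel_mode z m p * f p \<partial>lborel)"
proof -
  define g where "g p = bessel_mode z m (rotation (- \<phi>) p) * f p" for p
  have [measurable]: "g \<in> borel_measurable borel"
    unfolding g_def by measurable
  have "rotation (- \<phi>) (rotation \<phi> p) = p" for p
    by (simp add: rotation_add) (simp add: rotation_def)
  then have "(\<integral>p. bessel_mode z m p * rotate_fun \<phi> f p \<partial>lborel) = (\<integral>p. g (rotation \<phi> p) \<partial>lborel)"
    by (simp add: g_def rotate_fun_eq)
  also have "\<dots> = (\<integral>p. g p \<partial>lborel)" by (rule integral_rotation) measurable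
  also have "\<dots> = cis (of_int m * \<phi>) * (\<integral>p. bessel_mode z m p * f p \<partial>lborel)"
    by (simp add: g_def bessel_mode_rotation mult.assoc)
  finally show ?thesis .
qed

lemma norm_le_of_bounded_vector_derivative:
  fixes g :: "real \<Rightarrow> complex"
  assumes "\<And>t. t \<in> {a..b} \<Longrightarrow> g differentiable (at t)"
    and "\<And>t. t \<in> {a..b} \<Longrightarrow> cmod (vector_derivative g (at t)) \<le> B"
    and "s \<in> {a..b}" "t \<in> {a..b}"
  shows "cmod (g s - g t) \<le> B * \<bar>s - t\<bar>"
proof -
  have "norm (g s - g t) \<le> B * norm (s - t)"
  proof (rule differentiable_bound[of "{a..b}" g "\<lambda>x h. h *\<^sub>R vector_derivative g (at x)"])
    fix x assume x: "x \<in> {a..b}"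
    show "(g has_derivative (\<lambda>h. h *\<^sub>R vector_derivative g (at x))) (at x within {a..b})"
      using assms(1)[OF x] vector_derivative_works[of g "at x"]
      by (auto simp: has_vector_derivative_def intro: has_derivative_at_withinI)
    show "onorm (\<lambda>h. h *\<^sub>R vector_derivative g (at x)) \<le> B"
      using assms(2)[OF x] by (intro onorm_le) (simp add: mult.commute[of B] mult_left_mono)
  qed (use assms in auto)
  then show ?thesis by simp
qed

lemma Cq_imp_continuous: "Cq q f \<Longrightarrow> continuous_on UNIV f"
  by (cases q) auto

text \<open>The larger square is chosen because a rotation moves the unit square out of itself,
  though not beyond radius sqrt 2.\<close>

lemma Cq_imp_lipschitz:
  assumes "Cq (Suc q) f"
  obtains B where "B > 0" "\<And>p p'. p \<in> cbox (-2, -2) (2, 2) \<Longrightarrow> p' \<in> cbox (-2, -2) (2, 2) \<Longrightarrow>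
    cmod (f p - f p') \<le> B * (\<bar>fst p - fst p'\<bar> + \<bar>snd p - snd p'\<bar>)"
proof -
  define d1 where "d1 = (\<lambda>(x, y). vector_derivative (\<lambda>t. f (t, y)) (at x))"
  define d2 where "d2 = (\<lambda>(x, y). vector_derivative (\<lambda>t. f (x, t)) (at y))"
  have diff: "(\<lambda>t. f (t, y)) differentiable (at x)" "(\<lambda>t. f (x, t)) differentiable (at y)" for x y
    using assms by auto
  have "continuous_on UNIV d1" "continuous_on UNIV d2"
    using assms Cq_imp_continuous[of q d1] Cq_imp_continuous[of q d2] by (auto simp: d1_def d2_def)
  then have "bounded (d1 ` cbox (-2, -2) (2, 2))" "bounded (d2 ` cbox (-2, -2) (2, 2))"
    by (auto intro!: compact_imp_bounded compact_continuous_image intro: continuous_on_subset)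
  then obtain B1 B2 where B: "B1 > 0" "B2 > 0" "\<forall>p\<in>cbox (-2, -2) (2, 2). cmod (d1 p) \<le> B1"
      "\<forall>p\<in>cbox (-2, -2) (2, 2). cmod (d2 p) \<le> B2"
    unfolding bounded_pos by (metis image_eqI)
  show thesis
  proof (rule that[of "B1 + B2"])
    fix p p' :: "real \<times> real"
    assume "p \<in> cbox (-2, -2) (2, 2)" "p' \<in> cbox (-2, -2) (2, 2)"
    then obtain x y x' y' where p: "p = (x, y)" "p' = (x', y')" 
      and xy: "x \<in> {-2..2}" "y \<in> {-2..2}" "x' \<in> {-2..2}" "y' \<in> {-2..2}"
      by (cases p; cases p') auto
    \<comment> \<open>The derivatives at hand are partial ones, so the path from p to p' runs along
      two axis-parallel segments.\<close>
    have "cmod (f (x, y) - f (x', y)) \<le> B1 * \<bar>x - x'\<bar>"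
    proof (rule norm_le_of_bounded_vector_derivative[of "-2" 2 "\<lambda>t. f (t, y)"])
      fix t :: real assume "t \<in> {-2..2}"
      with xy have "(t, y) \<in> cbox (-2, -2) (2, 2)" by auto
      then show "cmod (vector_derivative (\<lambda>t. f (t, y)) (at t)) \<le> B1" using bspec[OF B(3), of "(t, y)"] by (simp add: d1_def)
    qed (use diff xy in auto)
    moreover have "cmod (f (x', y) - f (x', y')) \<le> B2 * \<bar>y - y'\<bar>"
    proof (rule norm_le_of_bounded_vector_derivative[of "-2" 2 "\<lambda>t. f (x', t)"])
      fix t :: real assume "t \<in> {-2..2}"
      with xy have "(x', t) \<in> cbox (-2, -2) (2, 2)" by auto
      then show "cmod (vector_derivative (\<lambda>t. f (x', t)) (at t)) \<le> B2" using bspec[OF B(4), of "(x', t)"] by (simp add: d2_def)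
    qed (use diff xy in auto)
    moreover have "cmod (f (x, y) - f (x', y')) \<le> cmod (f (x, y) - f (x', y)) + cmod (f (x', y) - f (x', y'))"
      using norm_triangle_ineq[of "f (x, y) - f (x', y)" "f (x', y) - f (x', y')"] by simp
    moreover have "B1 * \<bar>x - x'\<bar> + B2 * \<bar>y - y'\<bar> \<le> (B1 + B2) * (\<bar>x - x'\<bar> + \<bar>y - y'\<bar>)"
      using B(1,2) by (simp add: algebra_simps)
    ultimately show "cmod (f p - f p') \<le> (B1 + B2) * (\<bar>fst p - fst p'\<bar> + \<bar>snd p - snd p'\<bar>)"
      unfolding p by simp
  qed (use B in auto)
qed

theorem mainTheorem3:
  fixes f :: "real \<times> real \<Rightarrow> complex" and m :: int and n :: nat and \<phi> :: real
  assumes "Cq 2 f"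
    and "{x. f x \<noteq> 0} \<subseteq> ball 0 1"
    and "n \<ge> 1"
    and "0 \<le> \<phi>" and "\<phi> < 2 * pi"
  shows "\<exists>A>0. \<forall>K::nat. K \<ge> 1 \<and> int K \<ge> bessel_K m n \<longrightarrow>
           cmod (fourier_bessel K m n (rotate_fun \<phi> f)
                 - exp (\<i> * of_int m * of_real \<phi>) * fourier_bessel K m n f) \<le> A / real K"
proof -
  define z where "z = bessel_zero m n"
  define g where "g = rotate_fun \<phi> f"
  define I where "I h = (\<integral>p. bessel_mode z m p * h p \<partial>lborel)" for h
  define e where "e = cis (of_int m * \<phi>)"
  obtain \<kappa> where \<kappa>: "\<And>k. coeff_c k m n = \<kappa> * (\<integral>p. bessel_mode z m p * wave k p \<partial>lborel)"
    using coeff_c_eq_integral[OF assms(3)] unfolding z_def by blast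
  have cont: "continuous_on UNIV f" using assms(1) by (rule Cq_imp_continuous)
  have zero: "f p = 0" if "norm p \<ge> 1" for p
  proof (rule ccontr)
    assume "f p \<noteq> 0"
    then have "p \<in> ball 0 1" using assms(2) by blast
    with that show False by simp
  qed
  obtain B where B: "B > 0" and lip: "\<And>p q. p \<in> cbox (-2, -2) (2, 2) \<Longrightarrow> q \<in> cbox (-2, -2) (2, 2) \<Longrightarrow>
    cmod (f p - f q) \<le> B * (\<bar>fst p - fst q\<bar> + \<bar>snd p - snd q\<bar>)"
    using Cq_imp_lipschitz[of 1 f] assms(1) by (auto simp: numeral_2_eq_2)
  have contg: "continuous_on UNIV g"
    unfolding g_def rotate_fun_eq[abs_def] rotation_def
    by (intro continuous_on_compose2[OF cont] continuous_intros) auto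
  have zerog: "g p = 0" if "norm p \<ge> 1" for p
    unfolding g_def rotate_fun_eq by (rule zero) (simp add: that)
  \<comment> \<open>Each coordinate of a rotated difference is at most \<bar>dx\<bar> +
    \<bar>dy\<bar>, so the sum over both coordinates costs a factor 2.\<close>
  have lipg: "cmod (g p - g q) \<le> (2 * B) * (\<bar>fst p - fst q\<bar> + \<bar>snd p - snd q\<bar>)"
    if pq: "p \<in> unit_square" "q \<in> unit_square" for p q
  proof -
    have tri: "\<bar>a * c + b * d\<bar> \<le> \<bar>a\<bar> + \<bar>b\<bar>" if "\<bar>c\<bar> \<le> 1" "\<bar>d\<bar> \<le> 1" for a b c d :: real
      using mult_left_le[of "\<bar>c\<bar>" "\<bar>a\<bar>"] mult_left_le[of "\<bar>d\<bar>" "\<bar>b\<bar>"] that abs_triangle_ineq[of "a * c" "b * d"]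
      by (simp add: abs_mult)
    have sc: "\<bar>sin \<phi>\<bar> \<le> 1" "\<bar>cos \<phi>\<bar> \<le> 1" "\<bar>- sin \<phi>\<bar> \<le> 1" by simp_all
    have box: "rotation \<phi> r \<in> cbox (-2, -2) (2, 2)" if "r \<in> unit_square" for r
    proof -
      have "\<bar>fst r\<bar> \<le> 1" "\<bar>snd r\<bar> \<le> 1" using that by (cases r; auto simp: abs_le_iff)+
      then have "\<bar>fst (rotation \<phi> r)\<bar> \<le> 2" "\<bar>snd (rotation \<phi> r)\<bar> \<le> 2"
        using tri[OF sc(2,3), of "fst r" "snd r"] tri[OF sc(1,2), of "fst r" "snd r"]
        by (simp_all add: rotation_def)
      then show ?thesis by (cases "rotation \<phi> r") (auto simp: abs_le_iff)
    qed
    have "cmod (g p - g q) \<le> B * (\<bar>fst (rotation \<phi> p) - fst (rotation \<phi> q)\<bar> + \<bar>snd (rotation \<phi> p) - snd (rotation \<phi> q)\<bar>)"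
      unfolding g_def rotate_fun_eq by (intro lip box pq)
    also have "\<dots> \<le> B * ((\<bar>fst p - fst q\<bar> + \<bar>snd p - snd q\<bar>) + (\<bar>fst p - fst q\<bar> + \<bar>snd p - snd q\<bar>))"
      using tri[OF sc(2,3), of "fst p - fst q" "snd p - snd q"] tri[OF sc(1,2), of "fst p - fst q" "snd p - snd q"] B
      by (intro mult_left_mono add_mono) (simp_all add: rotation_def algebra_simps)
    finally show ?thesis by (simp add: algebra_simps)
  qed
  have sub: "unit_square \<subseteq> cbox (-2, -2) (2, 2)" by (auto simp: subset_iff)
  obtain A1 where A1: "A1 \<ge> 0" "\<And>K. K \<ge> 1 \<Longrightarrow> cmod (fourier_bessel K m n f - 4 * \<kappa> * I f) \<le> A1 / real K"
    using fourier_bessel_approximation[OF \<kappa> cont B lip[OF subsetD[OF sub] subsetD[OF sub]] zero]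
    unfolding I_def by blast
  obtain A2 where A2: "A2 \<ge> 0" "\<And>K. K \<ge> 1 \<Longrightarrow> cmod (fourier_bessel K m n g - 4 * \<kappa> * I g) \<le> A2 / real K"
    using fourier_bessel_approximation[OF \<kappa> contg _ lipg zerog] B unfolding I_def by auto
  have Ig: "I g = e * I f"
    unfolding I_def g_def e_def using borel_measurable_continuous_onI[OF cont]
    by (rule integral_bessel_mode_rotate_fun)
  \<comment> \<open>By \<open>Ig\<close> the limits cancel, and only the two approximation errors
    remain, one of them multiplied by the unimodular \<open>e\<close>. The summand 1 makes the
    constant positive.\<close>
  have "cmod (fourier_bessel K m n g - e * fourier_bessel K m n f) \<le> (A1 + A2 + 1) / real K" if K: "K \<ge> 1" for K
  proof -
    have "fourier_bessel K m n g - e * fourier_bessel K m n f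
        = (fourier_bessel K m n g - 4 * \<kappa> * I g) - e * (fourier_bessel K m n f - 4 * \<kappa> * I f)"
      by (simp add: Ig algebra_simps)
    also have "cmod \<dots> \<le> cmod (fourier_bessel K m n g - 4 * \<kappa> * I g) + cmod (e * (fourier_bessel K m n f - 4 * \<kappa> * I f))"
      by (rule norm_triangle_ineq4)
    also have "cmod (e * (fourier_bessel K m n f - 4 * \<kappa> * I f)) = cmod (fourier_bessel K m n f - 4 * \<kappa> * I f)"
      by (simp add: norm_mult e_def)
    also have "cmod (fourier_bessel K m n g - 4 * \<kappa> * I g) + \<dots> \<le> A2 / real K + A1 / real K"
      by (intro add_mono A1 A2 K)
    also have "\<dots> \<le> (A1 + A2 + 1) / real K" by (simp add: add_divide_distrib)
    finally show ?thesis .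
  qed
  moreover have "exp (\<i> * of_int m * of_real \<phi>) = e" by (simp add: e_def cis_conv_exp mult.assoc)
  ultimately show ?thesis
    using A1(1) A2(1) by (intro exI[of _ "A1 + A2 + 1"]) (auto simp: g_def)
qed

end
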